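(* Fix a computable function $f:\mathbb N\to\mathbb N$. There exists a Schnorr random $\omega\in2^{\mathbb N\times\mathbb N}$ which is $f$-Doob random but not e.c.u. random.
   Context: $2^{\mathbb N\times\mathbb N}$ carries the uniform (fair-coin product) measure and is identified with $(2^{\mathbb N})^{\mathbb N}$ via rows $\omega_m=(\omega_{m,0},\omega_{m,1},\dots)$; $\omega_{<n}=(\omega_0,\dots,\omega_{n-1})$, $\omega_{\ge n}=(\omega_n,\omega_{n+1},\dots)$, identified with elements of $2^{\mathbb N}$ via join. $\omega$ is Schnorr random if $\bigoplus_n\omega_n$ is Schnorr random in $2^{\mathbb N}$ (lies in no $\bigcap_kU_k$ for a computable sequence of effectively open $U_k$ with measures $\le2^{-k}$ computable uniformly in $k$). $\alpha\in2^{\mathbb N}$ is computably random uniformly relative to $\beta$ if there is no total computable map $\gamma\mapsto$ (name of a nonnegative martingale $d^\gamma:2^{<\mathbb N}\to\mathbb R$, $d^\gamma(\sigma)=\frac12(d^\gamma(\sigma0)+d^\gamma(\sigma1))$) with $\limsup_nd^\beta(\alpha_{<n})=\infty$. $\omega$ is e.c.u. random if for some $n$, $\omega_{\ge n}$ is computably random uniformly relative to $\omega_{<n}$. For computable $f$, $A_f=\{(m,n):f(m)>n\}$, $B_f=\{(m,n):f(m)\le n\}$, and $\omega_{A_f},\omega_{B_f}\in2^{\mathbb N}$ list the bits of $\omega$ at those indices in a fixed computable ordering. $\omega$ is $f$-Doob random if $\omega_{B_f}$ is computably random uniformly relative to $\omega_{A_f}$.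
   Formalization: The set A_f is assumed infinite; if A_f is finite (e.g. f = 0), ω_{A_f} is not an element of 2^ℕ, and f-Doob randomness would make ω computably random, hence e.c.u. random with n = 0, so the claim fails. *)

theory Defs
  imports
    "HOL-Probability.Probability"
    "HOL-Library.Nat_Bijection"
    "HOL-Library.Infinite_Set"
begin

section \<open>Computability relative to an oracle\<close>

text \<open>
  Programs for partial recursive functions with an oracle in Cantor space, and their
  denotational semantics (\<^term>\<open>None\<close> means divergence or an argument list of the wrong length).
\<close>

datatype prog =
    Zero
  | Succ
  | Proj nat
  | Oracle
  | Comp prog "prog list"
  | Prec prog prog
  | Mu prog

fun run :: "(nat \<Rightarrow> bool) \<Rightarrow> prog \<Rightarrow> nat list \<Rightarrow> nat option" where
  "run \<gamma> Zero xs = Some 0"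
| "run \<gamma> Succ xs = (case xs of [x] \<Rightarrow> Some (Suc x) | _ \<Rightarrow> None)"
| "run \<gamma> (Proj i) xs = (if i < length xs then Some (xs ! i) else None)"
| "run \<gamma> Oracle xs = (case xs of [x] \<Rightarrow> Some (if \<gamma> x then 1 else 0) | _ \<Rightarrow> None)"
| "run \<gamma> (Comp p qs) xs =
     (let ys = map (\<lambda>q. run \<gamma> q xs) qs
      in if None \<in> set ys then None else run \<gamma> p (map the ys))"
| "run \<gamma> (Prec p q) xs =
     (case xs of
        [] \<Rightarrow> None
      | n # ys \<Rightarrow>
          rec_nat (run \<gamma> p ys) (\<lambda>m r. Option.bind r (\<lambda>v. run \<gamma> q (m # v # ys))) n)"
| "run \<gamma> (Mu p) xs =
     (if \<exists>n. run \<gamma> p (n # xs) = Some 0 \<and> (\<forall>m<n. \<exists>v>0. run \<gamma> p (m # xs) = Some v)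
      then Some (LEAST n. run \<gamma> p (n # xs) = Some 0)
      else None)"

text \<open>Total computable maps from Cantor space to Baire space.\<close>

definition computable_map :: "((nat \<Rightarrow> bool) \<Rightarrow> (nat \<Rightarrow> nat)) \<Rightarrow> bool" where
  "computable_map \<Phi> \<longleftrightarrow> (\<exists>p. \<forall>\<gamma> x. run \<gamma> p [x] = Some (\<Phi> \<gamma> x))"

definition computable :: "(nat \<Rightarrow> nat) \<Rightarrow> bool" where
  "computable h \<longleftrightarrow> (\<exists>p. \<forall>x. run (\<lambda>_. False) p [x] = Some (h x))"

text \<open>
  A name of a nonnegative real is a sequence of numerators of dyadic approximations with
  error at most \<open>2\<^sup>-\<^sup>k\<close>; every nonnegative real has one, since the numerators may be
  taken to be natural numbers.
\<close>

definition real_name :: "(nat \<Rightarrow> nat) \<Rightarrow> real \<Rightarrow> bool" where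
  "real_name g x \<longleftrightarrow> (\<forall>k. \<bar>x - real (g k) / 2 ^ k\<bar> \<le> 1 / 2 ^ k)"


section \<open>Cantor space\<close>

text \<open>Bijective base-2 notation; a bijection from finite binary strings to the naturals.\<close>

fun str_code :: "bool list \<Rightarrow> nat" where
  "str_code [] = 0"
| "str_code (b # \<sigma>) = 2 * str_code \<sigma> + (if b then 2 else 1)"

definition prefix :: "(nat \<Rightarrow> bool) \<Rightarrow> nat \<Rightarrow> bool list" where
  "prefix \<alpha> n = map \<alpha> [0..<n]"

definition cylinder :: "bool list \<Rightarrow> (nat \<Rightarrow> bool) set" where
  "cylinder \<sigma> = {\<alpha>. prefix \<alpha> (length \<sigma>) = \<sigma>}"

definition coin :: "(nat \<Rightarrow> bool) measure" where
  "coin = (\<Pi>\<^sub>M i\<in>UNIV. measure_pmf (bernoulli_pmf (1 / 2)))"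


section \<open>Schnorr randomness\<close>

text \<open>
  The sets \<open>U k\<close> are open, uniformly effectively in \<open>k\<close>. A value \<open>0\<close> of the enumerating
  function contributes no cylinder, so that the empty set is covered.
\<close>

definition effectively_open_seq :: "(nat \<Rightarrow> (nat \<Rightarrow> bool) set) \<Rightarrow> bool" where
  "effectively_open_seq U \<longleftrightarrow>
     (\<exists>u. computable u \<and>
        (\<forall>k. U k = \<Union> {cylinder \<sigma> |\<sigma>. \<exists>i. u (prod_encode (k, i)) = Suc (str_code \<sigma>)}))"

definition computable_real_seq :: "(nat \<Rightarrow> real) \<Rightarrow> bool" where
  "computable_real_seq r \<longleftrightarrow>
     (\<exists>q. computable q \<and> (\<forall>k. real_name (\<lambda>j. q (prod_encode (k, j))) (r k)))"

definition schnorr_test :: "(nat \<Rightarrow> (nat \<Rightarrow> bool) set) \<Rightarrow> bool" where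
  "schnorr_test U \<longleftrightarrow>
     effectively_open_seq U \<and>
     (\<forall>k. measure coin (U k) \<le> 1 / 2 ^ k) \<and>
     computable_real_seq (\<lambda>k. measure coin (U k))"

definition schnorr_random :: "(nat \<Rightarrow> bool) \<Rightarrow> bool" where
  "schnorr_random \<alpha> \<longleftrightarrow> \<not> (\<exists>U. schnorr_test U \<and> \<alpha> \<in> (\<Inter>k. U k))"


section \<open>Uniformly relative computable randomness\<close>

definition nonneg_martingale :: "(bool list \<Rightarrow> real) \<Rightarrow> bool" where
  "nonneg_martingale d \<longleftrightarrow>
     (\<forall>\<sigma>. 0 \<le> d \<sigma> \<and> d \<sigma> = (d (\<sigma> @ [False]) + d (\<sigma> @ [True])) / 2)"

definition martingale_name :: "(nat \<Rightarrow> nat) \<Rightarrow> (bool list \<Rightarrow> real) \<Rightarrow> bool" where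
  "martingale_name g d \<longleftrightarrow>
     nonneg_martingale d \<and> (\<forall>\<sigma>. real_name (\<lambda>k. g (prod_encode (str_code \<sigma>, k))) (d \<sigma>))"

text \<open>\<open>\<alpha>\<close> is computably random uniformly relative to \<open>\<beta>\<close>.\<close>

definition comp_random_unif :: "(nat \<Rightarrow> bool) \<Rightarrow> (nat \<Rightarrow> bool) \<Rightarrow> bool" where
  "comp_random_unif \<alpha> \<beta> \<longleftrightarrow>
     \<not> (\<exists>\<Phi> d. computable_map \<Phi> \<and> (\<forall>\<gamma>. martingale_name (\<Phi> \<gamma>) (d \<gamma>)) \<and>
           limsup (\<lambda>n. ereal (d \<beta> (prefix \<alpha> n))) = \<infinity>)"


section \<open>Arrays of bits\<close>

text \<open>
  An element of $2^{N \times N}$ is a function \<open>\<omega> :: nat \<Rightarrow> nat \<Rightarrow> bool\<close>, with rows \<open>\<omega> m\<close>.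
\<close>

definition join :: "(nat \<Rightarrow> nat \<Rightarrow> bool) \<Rightarrow> (nat \<Rightarrow> bool)" where
  "join \<omega> i = (case prod_decode i of (m, j) \<Rightarrow> \<omega> m j)"

text \<open>
  The join of the first \<open>n\<close> rows interleaves them; the join of no rows is, by convention,
  the zero sequence.
\<close>

definition join_upto :: "nat \<Rightarrow> (nat \<Rightarrow> nat \<Rightarrow> bool) \<Rightarrow> (nat \<Rightarrow> bool)" where
  "join_upto n \<omega> i \<longleftrightarrow> 0 < n \<and> \<omega> (i mod n) (i div n)"

definition join_from :: "nat \<Rightarrow> (nat \<Rightarrow> nat \<Rightarrow> bool) \<Rightarrow> (nat \<Rightarrow> bool)" where
  "join_from n \<omega> = join (\<lambda>m. \<omega> (n + m))"

definition ecu_random :: "(nat \<Rightarrow> nat \<Rightarrow> bool) \<Rightarrow> bool" where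
  "ecu_random \<omega> \<longleftrightarrow> (\<exists>n. comp_random_unif (join_from n \<omega>) (join_upto n \<omega>))"

definition A_set :: "(nat \<Rightarrow> nat) \<Rightarrow> (nat \<times> nat) set" where
  "A_set f = {(m, n). f m > n}"

definition B_set :: "(nat \<Rightarrow> nat) \<Rightarrow> (nat \<times> nat) set" where
  "B_set f = {(m, n). f m \<le> n}"

text \<open>
  The bits of \<open>\<omega>\<close> at the indices in \<open>I\<close>, listed in increasing order of \<^const>\<open>prod_encode\<close>.
  This is meaningful for infinite \<open>I\<close> only.
\<close>

definition bits_at :: "(nat \<Rightarrow> nat \<Rightarrow> bool) \<Rightarrow> (nat \<times> nat) set \<Rightarrow> (nat \<Rightarrow> bool)" where
  "bits_at \<omega> I i = join \<omega> (enumerate (prod_encode ` I) i)"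

definition doob_random :: "(nat \<Rightarrow> nat) \<Rightarrow> (nat \<Rightarrow> nat \<Rightarrow> bool) \<Rightarrow> bool" where
  "doob_random f \<omega> \<longleftrightarrow> comp_random_unif (bits_at \<omega> (B_set f)) (bits_at \<omega> (A_set f))"

end

theory Submission
  imports Defs
begin

text \<open>
  Let \<open>t\<^sub>e\<close> be the halting time of program \<open>e\<close> on input \<open>e\<close>. Sums of more and more computable
  functions give an infinite set \<open>S\<close> of halting programs along which \<open>t\<^sub>e\<close> eventually
  dominates \<open>h e\<close> for every computable \<open>h\<close>. Force \<open>\<omega>\<close> to vanish on the first \<open>3e\<close> indices of
  \<open>A\<^sub>f\<close> beyond \<open>t\<^sub>e\<close>, for each \<open>e \<in> S\<close>, and toss fair coins everywhere else.

  The martingale that for every \<open>e\<close>, with weight \<open>2 ^ -(e + 1)\<close>, waits for \<open>e\<close> to halt and then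
  bets on \<open>3e\<close> zeros is total and computable without knowing \<open>S\<close>, and its capital tends to
  infinity. Each row contains only finitely many indices in \<open>A\<^sub>f\<close>, so dropping the first \<open>n\<close>
  rows does no harm and \<open>\<omega>\<close> is not e.c.u. random.

  A Schnorr test has a computable modulus \<open>N\<close> such that the first \<open>N m\<close> bits decide it up to measure
  about \<open>4 ^ -m\<close>. Only \<open>m + O(1)\<close> of these bits are forced, and \<open>n\<close> forced bits increase
  probabilities at most by the factor \<open>2 ^ n\<close>; so \<open>\<omega>\<close> passes the test almost surely. Finally the
  bits in \<open>B\<^sub>f\<close> are independent of those in \<open>A\<^sub>f\<close>, and by Ville's inequality they defeat each
  of the countably many martingales that use \<open>\<omega>\<close> on \<open>A\<^sub>f\<close> as an oracle.
\<close>

section \<open>Closure properties of computable functions\<close>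

abbreviation (input) no_oracle :: "nat \<Rightarrow> bool" where "no_oracle \<equiv> \<lambda>_. False"

text \<open>Pairing is shown computable from addition and triangular numbers first; this takes
  programs that read two separate arguments.\<close>

definition computable2 :: "(nat \<Rightarrow> nat \<Rightarrow> nat) \<Rightarrow> bool" where
  "computable2 h \<longleftrightarrow> (\<exists>p. \<forall>x y. run no_oracle p [x, y] = Some (h x y))"

definition pfst :: "nat \<Rightarrow> nat" where "pfst z = fst (prod_decode z)"
definition psnd :: "nat \<Rightarrow> nat" where "psnd z = snd (prod_decode z)"

lemma pfst_encode [simp]: "pfst (prod_encode (x, y)) = x"
  and psnd_encode [simp]: "psnd (prod_encode (x, y)) = y"
  by (simp_all add: pfst_def psnd_def)

lemma prod_encode_pfst_psnd [simp]: "prod_encode (pfst z, psnd z) = z"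
  by (simp add: pfst_def psnd_def)

lemma computable_id: "computable (\<lambda>x. x)"
  unfolding computable_def by (rule exI[of _ "Proj 0"]) simp

lemma computable_comp:
  assumes "computable g" "computable h"
  shows "computable (\<lambda>x. g (h x))"
proof -
  from assms obtain p q where "\<forall>x. run no_oracle p [x] = Some (g x)" "\<forall>x. run no_oracle q [x] = Some (h x)"
    unfolding computable_def by blast
  then have "\<forall>x. run no_oracle (Comp p [q]) [x] = Some (g (h x))" by simp
  then show ?thesis unfolding computable_def by blast
qed

lemma computable_Suc: "computable g \<Longrightarrow> computable (\<lambda>x. Suc (g x))"
  by (rule computable_comp[of Suc]) (auto simp: computable_def intro!: exI[of _ Succ])

lemma computable_const: "computable (\<lambda>_. c)"
proof (induction c)
  case 0
  show ?case unfolding computable_def by (rule exI[of _ Zero]) simp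
qed (rule computable_Suc)

lemma computable_comp2:
  assumes "computable2 F" "computable g" "computable h"
  shows "computable (\<lambda>x. F (g x) (h x))"
proof -
  from assms obtain p q r where "\<forall>x y. run no_oracle p [x, y] = Some (F x y)"
    "\<forall>x. run no_oracle q [x] = Some (g x)" "\<forall>x. run no_oracle r [x] = Some (h x)"
    unfolding computable_def computable2_def by blast
  then have "\<forall>x. run no_oracle (Comp p [q, r]) [x] = Some (F (g x) (h x))" by simp
  then show ?thesis unfolding computable_def by blast
qed

lemma computable2_comp:
  assumes "computable g" "computable2 F"
  shows "computable2 (\<lambda>x y. g (F x y))"
proof -
  from assms obtain p q where "\<forall>x. run no_oracle p [x] = Some (g x)" "\<forall>x y. run no_oracle q [x, y] = Some (F x y)"
    unfolding computable_def computable2_def by blast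
  then have "\<forall>x y. run no_oracle (Comp p [q]) [x, y] = Some (g (F x y))" by simp
  then show ?thesis unfolding computable2_def by blast
qed

lemma computable2_comp2:
  assumes "computable2 F" "computable2 g" "computable2 h"
  shows "computable2 (\<lambda>x y. F (g x y) (h x y))"
proof -
  from assms obtain p q r where "\<forall>x y. run no_oracle p [x, y] = Some (F x y)"
    "\<forall>x y. run no_oracle q [x, y] = Some (g x y)" "\<forall>x y. run no_oracle r [x, y] = Some (h x y)"
    unfolding computable2_def by blast
  then have "\<forall>x y. run no_oracle (Comp p [q, r]) [x, y] = Some (F (g x y) (h x y))" by simp
  then show ?thesis unfolding computable2_def by blast
qed

lemma computable2_fst: "computable2 (\<lambda>x y. x)"
  and computable2_snd: "computable2 (\<lambda>x y. y)"
  unfolding computable2_def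
  by (rule exI[of _ "Proj 0"], simp) (rule exI[of _ "Proj 1"], simp)

lemma computable2_rec:
  assumes "computable a" "computable2 s"
  shows "computable2 (\<lambda>n x. rec_nat (a x) (\<lambda>_ r. s r x) n)"
proof -
  from assms obtain p q where p: "\<And>x. run no_oracle p [x] = Some (a x)"
    and q: "\<And>r x. run no_oracle q [r, x] = Some (s r x)"
    unfolding computable_def computable2_def by blast
  have "run no_oracle (Prec p (Comp q [Proj 1, Proj 2])) [n, x]
      = Some (rec_nat (a x) (\<lambda>_ r. s r x) n)" for n x
    by (induction n) (simp_all add: p q)
  then show ?thesis unfolding computable2_def by blast
qed

lemma computable2_add: "computable2 (+)"
proof -
  have "rec_nat x (\<lambda>_ r. Suc r) n = n + x" for n x :: nat by (induction n) auto
  with computable2_rec[OF computable_id computable2_comp[OF computable_Suc[OF computable_id] computable2_fst]]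
  show ?thesis by simp
qed

lemma computable_pred: "computable (\<lambda>x. x - 1)"
proof -
  have "run no_oracle (Comp (Prec Zero (Proj 0)) [Proj 0, Proj 0]) [n] = Some (n - 1)" for n
    by (induction n) simp_all
  then show ?thesis unfolding computable_def by blast
qed

lemma computable2_mult: "computable2 (*)"
proof -
  have "rec_nat 0 (\<lambda>_ r. r + x) n = n * x" for n x :: nat by (induction n) auto
  with computable2_rec[OF computable_const[of 0] computable2_add]
  show ?thesis by simp
qed

lemma computable2_diff: "computable2 (-)"
proof -
  have "rec_nat x (\<lambda>_ r. r - 1) n = x - n" for n x :: nat by (induction n) auto
  with computable2_rec[OF computable_id computable2_comp[OF computable_pred computable2_fst]]
  have "computable2 (\<lambda>n x. x - n)" by simp
  from computable2_comp2[OF this computable2_snd computable2_fst] show ?thesis .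
qed

lemma computable_triangle: "computable triangle"
proof -
  obtain p where p: "\<And>x y. run no_oracle p [x, y] = Some (x + y)"
    using computable2_add unfolding computable2_def by blast
  have "run no_oracle (Comp (Prec Zero (Comp Succ [Comp p [Proj 0, Proj 1]])) [Proj 0, Proj 0]) [n] = Some (triangle n)" for n
    by (induction n) (simp_all add: p)
  then show ?thesis unfolding computable_def by blast
qed

lemma computable2_encode: "computable2 (\<lambda>x y. prod_encode (x, y))"
  unfolding prod_encode_def case_prod_conv
  by (rule computable2_comp2[OF computable2_add computable2_comp[OF computable_triangle computable2_add] computable2_fst])

section \<open>Decidable predicates, case distinction and search\<close>

definition decidable :: "(nat \<Rightarrow> bool) \<Rightarrow> bool" where
  "decidable P \<longleftrightarrow> computable (\<lambda>x. of_bool (P x))"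

lemmas computable_add = computable_comp2[OF computable2_add]
  and computable_mult = computable_comp2[OF computable2_mult]
  and computable_diff = computable_comp2[OF computable2_diff]
  and computable_encode = computable_comp2[OF computable2_encode]

lemma decidable_not:
  assumes "decidable P"
  shows "decidable (\<lambda>x. \<not> P x)"
proof -
  have "(\<lambda>x. of_bool (\<not> P x)) = (\<lambda>x. 1 - of_bool (P x) :: nat)" by auto
  then show ?thesis unfolding decidable_def
    using computable_diff[OF computable_const[of 1] assms[unfolded decidable_def]] by simp
qed

lemma decidable_conj:
  assumes "decidable P" "decidable Q"
  shows "decidable (\<lambda>x. P x \<and> Q x)"
  unfolding decidable_def of_bool_conj
  by (intro computable_mult assms[unfolded decidable_def])

lemma decidable_eq_0:
  assumes "computable g"
  shows "decidable (\<lambda>x. g x = 0)"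
proof -
  have "(\<lambda>x. of_bool (g x = 0)) = (\<lambda>x. 1 - g x)" by auto
  then show ?thesis unfolding decidable_def
    using computable_diff[OF computable_const[of 1] assms] by simp
qed

lemma decidable_le:
  assumes "computable g" "computable h"
  shows "decidable (\<lambda>x. g x \<le> h x)"
  using decidable_eq_0[OF computable_diff[OF assms]] by simp

lemma decidable_less:
  assumes "computable g" "computable h"
  shows "decidable (\<lambda>x. g x < h x)"
  using decidable_not[OF decidable_le[OF assms(2,1)]] by (simp add: not_le)

lemma decidable_eq:
  assumes "computable g" "computable h"
  shows "decidable (\<lambda>x. g x = h x)"
  using decidable_conj[OF decidable_le[OF assms] decidable_le[OF assms(2,1)]]
  by (simp add: order_eq_iff)

lemma computable_if:
  assumes "decidable P" "computable g" "computable h"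
  shows "computable (\<lambda>x. if P x then g x else h x)"
proof -
  have "(\<lambda>x. if P x then g x else h x) = (\<lambda>x. of_bool (P x) * g x + of_bool (\<not> P x) * h x)"
    by auto
  then show ?thesis
    using assms(1) decidable_not[OF assms(1)] assms(2,3) unfolding decidable_def
    by (simp only:) (intro computable_add computable_mult)
qed

text \<open>\<open>Mu\<close> prepends its search variable to the arguments, hence the order
  \<open>G y x\<close>.\<close>

lemma computable_Least2:
  assumes G: "computable2 G" and ex: "\<And>x. \<exists>y. G y x = 0"
  shows "computable (\<lambda>x. LEAST y. G y x = 0)"
proof -
  obtain p where p: "\<And>x y. run no_oracle p [x, y] = Some (G x y)"
    using G unfolding computable2_def by blast
  have "run no_oracle (Mu p) [x] = Some (LEAST y. G y x = 0)" for x
  proof -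
    obtain y where "G y x = 0" using ex by blast
    then have "G (LEAST y. G y x = 0) x = 0 \<and> (\<forall>m<(LEAST y. G y x = 0). 0 < G m x)"
      using LeastI[of "\<lambda>y. G y x = 0"] not_less_Least[of _ "\<lambda>y. G y x = 0"] neq0_conv by blast
    then have "\<exists>n. G n x = 0 \<and> (\<forall>m<n. 0 < G m x)" by blast
    then show ?thesis by (simp add: p)
  qed
  then show ?thesis unfolding computable_def by blast
qed

section \<open>Decoding pairs computably\<close>

lemma triangle_mono: "m \<le> n \<Longrightarrow> triangle m \<le> triangle n"
  by (induction n rule: dec_induct) auto

text \<open>Since \<open>prod_encode (x, y) = triangle (x + y) + x\<close>, the diagonal through
  \<open>z\<close> ends just before the next triangular number. A search therefore finds the
  diagonal, and \<open>pfst z\<close> is the offset along it.\<close>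

lemma psum_eq: "pfst z + psnd z = (LEAST s. z < triangle (Suc s))"
proof -
  obtain x y where z: "z = prod_encode (x, y)" by (metis prod_encode_pfst_psnd)
  have "(LEAST s. z < triangle (Suc s)) = x + y"
  proof (rule Least_equality)
    show "z < triangle (Suc (x + y))" by (simp add: z prod_encode_def)
    fix s assume "z < triangle (Suc s)"
    moreover have "triangle (x + y) \<le> z" by (simp add: z prod_encode_def)
    ultimately have "\<not> Suc s \<le> x + y"
      using triangle_mono[of "Suc s" "x + y"] by linarith
    then show "x + y \<le> s" by simp
  qed
  then show ?thesis by (simp add: z)
qed

lemma computable_psum: "computable (\<lambda>z. pfst z + psnd z)"
proof -
  have "computable2 (\<lambda>s z. Suc z - triangle (Suc s))"
    by (intro computable2_comp2[OF computable2_diff] computable2_comp[OF computable_triangle]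
        computable2_comp[OF computable_Suc[OF computable_id]] computable2_fst computable2_snd)
  moreover have "\<exists>y. Suc x - triangle (Suc y) = 0" for x
    by (rule exI[of _ x]) simp
  ultimately have "computable (\<lambda>z. LEAST s. Suc z - triangle (Suc s) = 0)"
    by (rule computable_Least2)
  then show ?thesis by (simp only: psum_eq diff_is_0_eq Suc_le_eq)
qed

lemma pfst_eq: "pfst z = z - triangle (pfst z + psnd z)"
proof -
  have "z = triangle (pfst z + psnd z) + pfst z"
    using prod_encode_pfst_psnd[of z] by (simp add: prod_encode_def)
  then show ?thesis by linarith
qed

lemma computable_pfst0: "computable pfst"
  using computable_diff[OF computable_id computable_comp[OF computable_triangle computable_psum]]
  by (simp add: pfst_eq[symmetric])

lemma computable_psnd0: "computable psnd"
  using computable_diff[OF computable_psum computable_pfst0] by simp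

lemmas computable_pfst = computable_comp[OF computable_pfst0]
lemmas computable_psnd = computable_comp[OF computable_psnd0]

section \<open>Search, recursion and bounded operations on paired arguments\<close>

lemma computable2I:
  assumes "computable (\<lambda>z. F (pfst z) (psnd z))"
  shows "computable2 F"
  using computable2_comp[OF assms computable2_encode] by simp

lemma computable_Least:
  assumes "decidable (\<lambda>z. P (pfst z) (psnd z))" and "\<And>x. \<exists>y. P x y"
  shows "computable (\<lambda>x. LEAST y. P x y)"
proof -
  have "decidable (\<lambda>z. \<not> P (psnd z) (pfst z))"
    using computable_comp[OF decidable_not[OF assms(1), unfolded decidable_def]
        computable_encode[OF computable_psnd0 computable_pfst0]]
    by (simp add: decidable_def)
  then have "computable2 (\<lambda>y x. of_bool (\<not> P x y))"
    unfolding decidable_def by (rule computable2I)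
  from computable_Least2[OF this] assms(2) show ?thesis by simp
qed

text \<open>Pairing packs the parameter, the counter and the previous value, in this order, into the
  single argument of the step function.\<close>

lemma computable_rec:
  assumes "computable n" "computable a" "computable (\<lambda>z. s (pfst z) (pfst (psnd z)) (psnd (psnd z)))"
  shows "computable (\<lambda>x. rec_nat (a x) (s x) (n x))"
proof -
  obtain p where p: "\<And>x. run no_oracle p [x] = Some (a x)"
    using assms(2) unfolding computable_def by blast
  obtain q where q: "\<And>z. run no_oracle q [z] = Some (s (pfst z) (pfst (psnd z)) (psnd (psnd z)))"
    using assms(3) unfolding computable_def by blast
  obtain r where r: "\<And>x y. run no_oracle r [x, y] = Some (prod_encode (x, y))"
    using computable2_encode unfolding computable2_def by blast
  have "run no_oracle (Prec p (Comp q [Comp r [Proj 2, Comp r [Proj 0, Proj 1]]])) [m, x]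
      = Some (rec_nat (a x) (s x) m)" for m x
    by (induction m) (simp_all add: p q r)
  then have "computable2 (\<lambda>m x. rec_nat (a x) (s x) m)" unfolding computable2_def by blast
  from computable_comp2[OF this assms(1) computable_id] show ?thesis .
qed

lemma computable_sum:
  assumes "computable (\<lambda>z. F (pfst z) (psnd z))" "computable n"
  shows "computable (\<lambda>x. \<Sum>i<n x. F x i)"
proof -
  have eq: "(\<Sum>i<m. F x i) = rec_nat 0 (\<lambda>i r. r + F x i) m" for x m
    by (induction m) auto
  have "computable (\<lambda>z. F (pfst z) (pfst (psnd z)))"
    using computable_comp[OF assms(1) computable_encode[OF computable_pfst0 computable_pfst[OF computable_psnd0]]]
    by simp
  then show ?thesis unfolding eq
    by (intro computable_rec assms computable_const computable_add computable_psnd computable_id)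
qed

lemma computable_prod:
  assumes "computable (\<lambda>z. F (pfst z) (psnd z))" "computable n"
  shows "computable (\<lambda>x. \<Prod>i<n x. F x i)"
proof -
  have eq: "(\<Prod>i<m. F x i) = rec_nat 1 (\<lambda>i r. r * F x i) m" for x m
    by (induction m) auto
  have "computable (\<lambda>z. F (pfst z) (pfst (psnd z)))"
    using computable_comp[OF assms(1) computable_encode[OF computable_pfst0 computable_pfst[OF computable_psnd0]]]
    by simp
  then show ?thesis unfolding eq
    by (intro computable_rec assms computable_const computable_mult computable_psnd computable_id)
qed

lemma computable_power:
  assumes "computable g" "computable n"
  shows "computable (\<lambda>x. g x ^ n x)"
  using computable_prod[OF computable_comp[OF assms(1) computable_pfst0] assms(2)] by simp

lemma computable_funpow:
  assumes "computable s" "computable n" "computable a"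
  shows "computable (\<lambda>x. (s ^^ n x) (a x))"
proof -
  have eq: "(s ^^ m) y = rec_nat y (\<lambda>_. s) m" for m y by (induction m) auto
  show ?thesis unfolding eq
    by (intro computable_rec assms computable_comp[OF assms(1)] computable_psnd computable_id)
qed

lemma decidable_ball:
  assumes "decidable (\<lambda>z. P (pfst z) (psnd z))" "computable n"
  shows "decidable (\<lambda>x. \<forall>i<n x. P x i)"
proof -
  have eq: "of_bool (\<forall>i<m. P x i) = (\<Prod>i<m. of_bool (P x i) :: nat)" for x m
    by (induction m) (auto simp: less_Suc_eq)
  show ?thesis unfolding decidable_def eq
    by (intro computable_prod assms(2) assms(1)[unfolded decidable_def])
qed

lemma decidable_bex:
  assumes "decidable (\<lambda>z. P (pfst z) (psnd z))" "computable n"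
  shows "decidable (\<lambda>x. \<exists>i<n x. P x i)"
  using decidable_not[OF decidable_ball[OF decidable_not[OF assms(1)] assms(2)]] by simp

lemma computable_card:
  assumes "decidable (\<lambda>z. P (pfst z) (psnd z))" "computable n"
  shows "computable (\<lambda>x. card {i. i < n x \<and> P x i})"
proof -
  have eq: "card {i. i < m \<and> P x i} = (\<Sum>i<m. of_bool (P x i))" for x m
    by (simp add: sum_of_bool_eq Int_def)
  show ?thesis unfolding eq
    by (intro computable_sum assms(2) assms(1)[unfolded decidable_def])
qed

lemma computable_div:
  assumes "computable g" "computable h" "\<And>x. h x > 0"
  shows "computable (\<lambda>x. g x div h x)"
proof -
  have eq: "g x div h x = (LEAST y. g x < h x * Suc y)" for x
  proof (rule Least_equality[symmetric])
    show "g x < h x * Suc (g x div h x)"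
      using dividend_less_times_div[of "h x" "g x"] assms(3)[of x] by simp
    fix y assume "g x < h x * Suc y"
    then show "g x div h x \<le> y"
      by (metis less_Suc_eq_le less_mult_imp_div_less mult.commute)
  qed
  show ?thesis unfolding eq
  proof (rule computable_Least)
    show "decidable (\<lambda>z. g (pfst z) < h (pfst z) * Suc (psnd z))"
      by (intro decidable_less computable_mult computable_Suc computable_psnd computable_id
          computable_comp[OF assms(1)] computable_comp[OF assms(2)] computable_pfst)
    show "\<exists>y. g x < h x * Suc y" for x
      using dividend_less_times_div[of "h x" "g x"] assms(3)[of x]
      by (intro exI[of _ "g x div h x"]) simp
  qed
qed

lemma computable_mod:
  assumes "computable g" "computable h" "\<And>x. h x > 0"
  shows "computable (\<lambda>x. g x mod h x)"
  unfolding modulo_nat_def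
  by (intro computable_diff computable_mult computable_div assms)

lemma decidable_odd:
  assumes "computable g"
  shows "decidable (\<lambda>x. odd (g x))"
  using computable_mod[OF assms computable_const[of 2]]
  by (simp add: decidable_def mod_2_eq_odd)

lemmas computable_intros =
  computable_id computable_const computable_Suc computable_add computable_mult computable_diff
  computable_encode computable_pfst computable_psnd computable_power computable_if
  decidable_not decidable_conj decidable_eq decidable_le decidable_less
  decidable_ball decidable_bex decidable_odd computable_sum computable_prod computable_card

text \<open>\<open>computable\<close> refers to the all-false oracle, whereas a computable map has
  to work under every oracle; answering each query by 0 reconciles the two.
  \<open>Comp Zero [Succ]\<close> instead of \<open>Zero\<close> preserves divergence on argument
  lists of the wrong length.\<close>

primrec strip_oracle :: "prog \<Rightarrow> prog" where
  "strip_oracle Zero = Zero"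
| "strip_oracle Succ = Succ"
| "strip_oracle (Proj i) = Proj i"
| "strip_oracle Oracle = Comp Zero [Succ]"
| "strip_oracle (Comp p qs) = Comp (strip_oracle p) (map strip_oracle qs)"
| "strip_oracle (Prec p q) = Prec (strip_oracle p) (strip_oracle q)"
| "strip_oracle (Mu p) = Mu (strip_oracle p)"

lemma run_strip_oracle: "run \<gamma> (strip_oracle p) xs = run no_oracle p xs"
proof (induction p arbitrary: xs)
  case (Comp p qs)
  have "map (\<lambda>q. run \<gamma> q xs) (map strip_oracle qs) = map (\<lambda>q. run no_oracle q xs) qs"
    using Comp(2) by simp
  then show ?case by (simp only: strip_oracle.simps run.simps Comp(1))
next
  case (Prec p q)
  then show ?case by (simp split: list.split)
qed (auto split: list.split)

lemma computable_map_const: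
  assumes "computable h"
  shows "computable_map (\<lambda>_. h)"
proof -
  obtain p where "\<And>x. run no_oracle p [x] = Some (h x)"
    using assms unfolding computable_def by blast
  then have "\<forall>\<gamma> x. run \<gamma> (strip_oracle p) [x] = Some (h x)" by (simp add: run_strip_oracle)
  then show ?thesis unfolding computable_map_def by blast
qed

section \<open>A universal stepping machine\<close>

text \<open>Instruction stacks and argument lists share the coding of \<open>list_encode\<close>,
  with 0 as the empty list.\<close>

definition ncons :: "nat \<Rightarrow> nat \<Rightarrow> nat" where "ncons x l = Suc (prod_encode (x, l))"
definition nhd :: "nat \<Rightarrow> nat" where "nhd l = pfst (l - 1)"
definition ntl :: "nat \<Rightarrow> nat" where "ntl l = psnd (l - 1)"
definition instr :: "nat \<Rightarrow> nat \<Rightarrow> nat \<Rightarrow> nat" where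
  "instr t a b = prod_encode (t, prod_encode (a, b))"
definition config :: "nat \<Rightarrow> nat \<Rightarrow> nat" where "config k v = prod_encode (k, v)"

lemma nhd_ncons [simp]: "nhd (ncons x l) = x"
  and ntl_ncons [simp]: "ntl (ncons x l) = l"
  and ncons_neq_0 [simp]: "ncons x l \<noteq> 0"
  by (simp_all add: ncons_def nhd_def ntl_def)

lemma list_encode_Cons [simp]: "list_encode (x # xs) = ncons x (list_encode xs)"
  by (simp add: ncons_def)

declare list_encode.simps(2) [simp del]

text \<open>
  A configuration consists of a stack of instructions and a value, which is either an argument
  list or a result. The instructions 5, 6, 9 and 11 are pushed only by \<open>step\<close> itself and store
  intermediate values; 4 and 7 are pairing and composition, 8 and 10 primitive recursion and
  unbounded search (starting at the head of the value), 12 is the identity.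
\<close>

definition step :: "nat \<Rightarrow> nat" where
  "step c =
    (if pfst c = 0 then c
     else if pfst (nhd (pfst c)) = 0 then config (ntl (pfst c)) 0
     else if pfst (nhd (pfst c)) = 1 then config (ntl (pfst c)) (Suc (nhd (psnd c)))
     else if pfst (nhd (pfst c)) = 2 then config (ntl (pfst c)) (nhd (psnd c))
     else if pfst (nhd (pfst c)) = 3 then config (ntl (pfst c)) (ntl (psnd c))
     else if pfst (nhd (pfst c)) = 4 then
       config (ncons (pfst (psnd (nhd (pfst c)))) (ncons (instr 5 (psnd (psnd (nhd (pfst c)))) (psnd c)) (ntl (pfst c)))) (psnd c)
     else if pfst (nhd (pfst c)) = 5 then
       config (ncons (pfst (psnd (nhd (pfst c)))) (ncons (instr 6 (psnd c) 0) (ntl (pfst c)))) (psnd (psnd (nhd (pfst c))))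
     else if pfst (nhd (pfst c)) = 6 then
       config (ntl (pfst c)) (ncons (pfst (psnd (nhd (pfst c)))) (psnd c))
     else if pfst (nhd (pfst c)) = 7 then
       config (ncons (pfst (psnd (nhd (pfst c)))) (ncons (psnd (psnd (nhd (pfst c)))) (ntl (pfst c)))) (psnd c)
     else if pfst (nhd (pfst c)) = 8 then
       (if nhd (psnd c) = 0 then config (ncons (pfst (psnd (nhd (pfst c)))) (ntl (pfst c))) (ntl (psnd c))
        else config (ncons (nhd (pfst c))
               (ncons (instr 9 (psnd (psnd (nhd (pfst c)))) (ncons (nhd (psnd c) - 1) (ntl (psnd c)))) (ntl (pfst c))))
               (ncons (nhd (psnd c) - 1) (ntl (psnd c))))
     else if pfst (nhd (pfst c)) = 9 then
       config (ncons (pfst (psnd (nhd (pfst c)))) (ntl (pfst c)))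
         (ncons (nhd (psnd (psnd (nhd (pfst c))))) (ncons (psnd c) (ntl (psnd (psnd (nhd (pfst c)))))))
     else if pfst (nhd (pfst c)) = 10 then
       config (ncons (pfst (psnd (nhd (pfst c)))) (ncons (instr 11 (pfst (psnd (nhd (pfst c)))) (psnd c)) (ntl (pfst c)))) (psnd c)
     else if pfst (nhd (pfst c)) = 11 then
       (if psnd c = 0 then config (ntl (pfst c)) (nhd (psnd (psnd (nhd (pfst c)))))
        else config (ncons (instr 10 (pfst (psnd (nhd (pfst c)))) 0) (ntl (pfst c)))
               (ncons (Suc (nhd (psnd (psnd (nhd (pfst c)))))) (ntl (psnd (psnd (nhd (pfst c)))))))
     else config (ntl (pfst c)) (psnd c))"

lemma step_simps [simp]:
  "step (config 0 v) = config 0 v"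
  "step (config (ncons (instr 0 a b) k) v) = config k 0"
  "step (config (ncons (instr 1 a b) k) v) = config k (Suc (nhd v))"
  "step (config (ncons (instr 2 a b) k) v) = config k (nhd v)"
  "step (config (ncons (instr 3 a b) k) v) = config k (ntl v)"
  "step (config (ncons (instr 4 a b) k) v) = config (ncons a (ncons (instr 5 b v) k)) v"
  "step (config (ncons (instr 5 a b) k) v) = config (ncons a (ncons (instr 6 v 0) k)) b"
  "step (config (ncons (instr 6 a b) k) v) = config k (ncons a v)"
  "step (config (ncons (instr 7 a b) k) v) = config (ncons a (ncons b k)) v"
  "step (config (ncons (instr 8 a b) k) (ncons 0 y)) = config (ncons a k) y"
  "step (config (ncons (instr 8 a b) k) (ncons (Suc n) y)) =
     config (ncons (instr 8 a b) (ncons (instr 9 b (ncons n y)) k)) (ncons n y)"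
  "step (config (ncons (instr 9 a (ncons n y)) k) v) = config (ncons a k) (ncons n (ncons v y))"
  "step (config (ncons (instr 10 a b) k) v) = config (ncons a (ncons (instr 11 a v) k)) v"
  "step (config (ncons (instr 11 a (ncons n y)) k) 0) = config k n"
  "step (config (ncons (instr 11 a (ncons n y)) k) (Suc v)) =
     config (ncons (instr 10 a 0) k) (ncons (Suc n) y)"
  "step (config (ncons (instr 12 a b) k) v) = config k v"
  by (simp_all add: step_def instr_def config_def)

lemma computable_ncons: "computable g \<Longrightarrow> computable h \<Longrightarrow> computable (\<lambda>x. ncons (g x) (h x))"
  and computable_config: "computable g \<Longrightarrow> computable h \<Longrightarrow> computable (\<lambda>x. config (g x) (h x))"
  and computable_nhd: "computable g \<Longrightarrow> computable (\<lambda>x. nhd (g x))"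
  and computable_ntl: "computable g \<Longrightarrow> computable (\<lambda>x. ntl (g x))"
  and computable_instr: "computable g \<Longrightarrow> computable h \<Longrightarrow> computable (\<lambda>x. instr t (g x) (h x))"
  unfolding ncons_def config_def nhd_def ntl_def instr_def by (intro computable_intros; assumption)+

lemma computable_step: "computable step"
  unfolding step_def
  by (intro computable_ncons computable_config computable_nhd computable_ntl computable_instr computable_intros)

section \<open>Compiling programs and simulating their runs\<close>

definition reaches :: "nat \<Rightarrow> nat \<Rightarrow> bool" where
  "reaches c c' \<longleftrightarrow> (\<exists>n. (step ^^ n) c = c')"

lemma reaches_refl: "reaches c c"
  unfolding reaches_def by (rule exI[of _ 0]) simp

lemma reaches_trans: "reaches a b \<Longrightarrow> reaches b c \<Longrightarrow> reaches a c"
  unfolding reaches_def by (metis comp_apply funpow_add)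

lemma reaches_step: "step a = b \<Longrightarrow> reaches b c \<Longrightarrow> reaches a c"
  by (rule reaches_trans[of _ b]) (auto simp: reaches_def intro: exI[of _ 1])

text \<open>Instruction 0 yields the empty list. Each instruction 4 evaluates one argument, restores
  the original input for the rest, and finally conses the saved value onto their list.\<close>

primrec compile_args :: "nat list \<Rightarrow> nat" where
  "compile_args [] = instr 0 0 0"
| "compile_args (c # cs) = instr 4 c (compile_args cs)"

primrec compile_proj :: "nat \<Rightarrow> nat" where
  "compile_proj 0 = instr 2 0 0"
| "compile_proj (Suc i) = instr 7 (instr 3 0 0) (compile_proj i)"

text \<open>A query compiles to 0, its answer under the all-false oracle. For \<open>Mu\<close>, the
  code first conses 0 onto the arguments, because instruction 10 searches upwards from the
  head.\<close>

primrec compile :: "prog \<Rightarrow> nat" where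
  "compile Zero = instr 0 0 0"
| "compile Succ = instr 1 0 0"
| "compile (Proj i) = compile_proj i"
| "compile Oracle = instr 0 0 0"
| "compile (Comp p qs) = instr 7 (compile_args (map compile qs)) (compile p)"
| "compile (Prec p q) = instr 8 (compile p) (compile q)"
| "compile (Mu p) = instr 7 (instr 4 (instr 0 0 0) (instr 12 0 0)) (instr 10 (compile p) 0)"

lemma reaches_proj:
  assumes "i < length xs"
  shows "reaches (config (ncons (compile_proj i) k) (list_encode xs)) (config k (xs ! i))"
  using assms
proof (induction i arbitrary: xs)
  case 0
  then obtain y ys where "xs = y # ys" by (cases xs) auto
  then show ?case by (intro reaches_step[OF _ reaches_refl]) simp
next
  case (Suc i)
  then obtain y ys where xs: "xs = y # ys" by (cases xs) auto
  with Suc have "reaches (config (ncons (compile_proj i) k) (list_encode ys)) (config k (ys ! i))" by simp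
  then show ?case
    by (simp add: xs) (rule reaches_step, simp, rule reaches_step, simp, simp)
qed

lemma reaches_args:
  assumes "\<And>q k. q \<in> set qs \<Longrightarrow> reaches (config (ncons (compile q) k) x) (config k (val q))"
  shows "reaches (config (ncons (compile_args (map compile qs)) k) x) (config k (list_encode (map val qs)))"
  using assms
proof (induction qs arbitrary: k)
  case Nil
  then show ?case by (intro reaches_step[OF _ reaches_refl]) simp
next
  case (Cons q qs)
  have "reaches (config (ncons (compile_args (map compile qs)) (ncons (instr 6 (val q) 0) k)) x)
          (config (ncons (instr 6 (val q) 0) k) (list_encode (map val qs)))"
    using Cons by simp
  then have "reaches (config (ncons (compile_args (map compile qs)) (ncons (instr 6 (val q) 0) k)) x)
     (config k (list_encode (map val (q # qs))))"
    by (rule reaches_trans) (intro reaches_step[OF _ reaches_refl], simp)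
  then have "reaches (config (ncons (instr 5 (compile_args (map compile qs)) x) k) (val q))
     (config k (list_encode (map val (q # qs))))"
    by (rule reaches_step[rotated]) simp
  from reaches_trans[OF Cons.prems[of q] this]
  show ?case by - (rule reaches_step, simp, simp)
qed

text \<open>The remaining stack \<open>k\<close> is arbitrary, so runs of subprograms can be
  chained. Convergent runs suffice, since the functions to be dominated are total.\<close>

lemma reaches_compile:
  assumes "run no_oracle p xs = Some v"
  shows "reaches (config (ncons (compile p) k) (list_encode xs)) (config k v)"
  using assms
proof (induction p arbitrary: xs v k)
  case Zero
  then show ?case by (intro reaches_step[OF _ reaches_refl]) simp
next
  case Succ
  then show ?case
    by (intro reaches_step[OF _ reaches_refl]) (auto simp del: One_nat_def split: list.splits)
next
  case (Proj i)
  then show ?case using reaches_proj[of i xs] by (simp split: if_splits)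
next
  case Oracle
  then show ?case by (intro reaches_step[OF _ reaches_refl]) (auto split: list.splits)
next
  case (Comp p qs)
  define val where "val = (\<lambda>q. the (run no_oracle q xs))"
  have def: "\<forall>q\<in>set qs. run no_oracle q xs = Some (val q)"
    and v: "run no_oracle p (map val qs) = Some v"
    using Comp.prems by (auto simp: val_def comp_def Let_def image_iff split: if_splits)
  have "reaches (config (ncons (compile_args (map compile qs)) (ncons (compile p) k)) (list_encode xs))
      (config (ncons (compile p) k) (list_encode (map val qs)))"
    using Comp.IH(2) def by (intro reaches_args) blast
  from reaches_trans[OF this Comp.IH(1)[OF v]]
  show ?case by - (rule reaches_step, simp, simp)
next
  case (Prec p q)
  then obtain n ys where xs: "xs = n # ys" by (cases xs) auto
  have "rec_nat (run no_oracle p ys) (\<lambda>m r. Option.bind r (\<lambda>v. run no_oracle q (m # v # ys))) n = Some v \<Longrightarrow>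
     reaches (config (ncons (instr 8 (compile p) (compile q)) k) (ncons n (list_encode ys))) (config k v)"
  proof (induction n arbitrary: v k)
    case 0
    from Prec.IH(1)[of ys v k] 0 show ?case by - (rule reaches_step, simp, simp)
  next
    case (Suc n)
    then obtain w where w: "rec_nat (run no_oracle p ys) (\<lambda>m r. Option.bind r (\<lambda>v. run no_oracle q (m # v # ys))) n = Some w"
      and v: "run no_oracle q (n # w # ys) = Some v"
      by (auto simp: bind_eq_Some_conv)
    have "reaches (config (ncons (instr 9 (compile q) (ncons n (list_encode ys))) k) w) (config k v)"
      using Prec.IH(2)[OF v, of k] by - (rule reaches_step, simp, simp)
    from reaches_trans[OF Suc.IH[OF w] this]
    show ?case by - (rule reaches_step, simp, simp)
  qed
  then show ?case using Prec.prems by (simp add: xs)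
next
  case (Mu p)
  from Mu.prems have ex: "\<exists>n. run no_oracle p (n # xs) = Some 0 \<and> (\<forall>m<n. \<exists>w>0. run no_oracle p (m # xs) = Some w)"
    and v: "v = (LEAST n. run no_oracle p (n # xs) = Some 0)"
    by (auto split: if_splits)
  then obtain n where n: "run no_oracle p (n # xs) = Some 0"
      "\<And>m. m < n \<Longrightarrow> \<exists>w>0. run no_oracle p (m # xs) = Some w" by blast
  have "v = n" unfolding v
  proof (rule Least_equality)
    fix m assume "run no_oracle p (m # xs) = Some 0"
    then show "n \<le> m" using n(2)[of m] by (cases "m < n") auto
  qed (rule n(1))
  \<comment> \<open>Descending induction on the counter, from the zero found at \<open>n\<close>: a
    positive value sends the machine on to the next counter.\<close>
  have "reaches (config (ncons (instr 10 (compile p) 0) k) (list_encode (m # xs))) (config k n)" if "m \<le> n" for m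
    using that
  proof (induction m rule: inc_induct)
    case base
    have "reaches (config (ncons (instr 11 (compile p) (list_encode (n # xs))) k) 0) (config k n)"
      by (intro reaches_step[OF _ reaches_refl]) simp
    from reaches_trans[OF Mu.IH[OF n(1)] this]
    show ?case by - (rule reaches_step, simp, simp)
  next
    case (step m)
    then obtain w where w: "run no_oracle p (m # xs) = Some (Suc w)"
      using n(2)[of m] step.hyps by (auto simp: gr0_conv_Suc)
    have "reaches (config (ncons (instr 11 (compile p) (list_encode (m # xs))) k) (Suc w)) (config k n)"
      using step.IH by - (rule reaches_step, simp, simp)
    from reaches_trans[OF Mu.IH[OF w] this]
    show ?case by - (rule reaches_step, simp, simp)
  qed
  from this[of 0] have 0: "reaches (config (ncons (instr 10 (compile p) 0) k) (ncons 0 (list_encode xs))) (config k v)"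
    using \<open>v = n\<close> by simp
  \<comment> \<open>Six machine steps (instructions 7, 4, 0, 5, 12, 6) put the counter 0 in front of
    the arguments.\<close>
  show ?case unfolding compile.simps
    apply (rule reaches_step, rule step_simps)
    apply (rule reaches_step, rule step_simps)
    apply (rule reaches_step, rule step_simps)
    apply (rule reaches_step, rule step_simps)
    apply (rule reaches_step, rule step_simps)
    apply (rule reaches_step, rule step_simps)
    apply (rule 0)
    done
qed

text \<open>
  Code \<open>e\<close> runs on its own index \<open>e\<close>. The bound on the output makes halting times dominate
  the computed values.
\<close>

definition halts_by :: "nat \<Rightarrow> nat \<Rightarrow> bool" where
  "halts_by e t \<longleftrightarrow> pfst ((step ^^ t) (config (ncons e 0) (ncons e 0))) = 0
     \<and> psnd ((step ^^ t) (config (ncons e 0) (ncons e 0))) \<le> t"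

lemma decidable_halts_by: "decidable (\<lambda>z. halts_by (pfst z) (psnd z))"
  unfolding halts_by_def
  by (intro computable_ncons computable_config computable_funpow[OF computable_step] computable_intros)

lemma pfst_config [simp]: "pfst (config k v) = k" and psnd_config [simp]: "psnd (config k v) = v"
  by (simp_all add: config_def)

lemma step_fixed: "pfst c = 0 \<Longrightarrow> (step ^^ n) c = c"
  by (induction n) (simp_all add: step_def)

lemma halts_by_stable:
  assumes "pfst ((step ^^ t) c) = 0" "t \<le> t'"
  shows "(step ^^ t') c = (step ^^ t) c"
proof -
  have "(step ^^ ((t' - t) + t)) c = (step ^^ t) c"
    using step_fixed[OF assms(1)] by (simp only: funpow_add comp_apply)
  then show ?thesis using assms(2) by simp
qed

lemma halts_by_mono: "halts_by e t \<Longrightarrow> t \<le> t' \<Longrightarrow> halts_by e t'"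
  unfolding halts_by_def using halts_by_stable[of t _ t'] by auto

text \<open>A halted configuration never changes, so every halting stage shows the same output
  \<open>h (compile p)\<close>, which \<open>halts_by\<close> bounds by the time.\<close>

lemma halts_by_compile:
  assumes "\<And>x. run no_oracle p [x] = Some (h x)"
  shows "\<exists>t. halts_by (compile p) t" and "halts_by (compile p) t \<Longrightarrow> h (compile p) \<le> t"
proof -
  let ?c = "config (ncons (compile p) 0) (ncons (compile p) 0)"
  obtain n where n: "(step ^^ n) ?c = config 0 (h (compile p))"
    using reaches_compile[OF assms[of "compile p"], of 0] by (auto simp: reaches_def)
  have "halts_by (compile p) (max n (h (compile p)))"
    using halts_by_stable[of n ?c "max n (h (compile p))"] n by (simp add: halts_by_def)
  then show "\<exists>t. halts_by (compile p) t" ..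
  show "h (compile p) \<le> t" if "halts_by (compile p) t"
  proof -
    have "(step ^^ max n t) ?c = (step ^^ t) ?c" "(step ^^ max n t) ?c = (step ^^ n) ?c"
      using that halts_by_stable[of t ?c "max n t"] halts_by_stable[of n ?c "max n t"] n
      by (simp_all add: halts_by_def)
    then show ?thesis using that unfolding halts_by_def by (metis n psnd_config)
  qed
qed

section \<open>A set of programs whose halting times dominate\<close>

instance prog :: countable
  by countable_datatype

lemma countable_computable: "countable {h. computable h}"
proof -
  have "{h. computable h} \<subseteq> range (\<lambda>p x. the (run no_oracle p [x]))"
  proof safe
    fix h assume "computable h"
    then obtain p where "\<And>x. run no_oracle p [x] = Some (h x)" unfolding computable_def by blast
    then have "h = (\<lambda>x. the (run no_oracle p [x]))" by (simp add: fun_eq_iff)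
    then show "h \<in> range (\<lambda>p x. the (run no_oracle p [x]))" by (rule image_eqI) simp
  qed
  then show ?thesis by (rule countable_subset) simp
qed

lemma computable_sum_fixed:
  fixes i :: nat
  assumes "\<And>j. computable (h j)"
  shows "computable (\<lambda>x. \<Sum>j\<le>i. Suc (h j x))"
  by (induction i) (auto intro!: computable_Suc computable_add assms)

text \<open>\<open>S\<close> consists of codes of the partial sums of an enumeration of all
  computable functions. A code's halting time bounds its output, and from the \<open>j\<close>-th
  sum on this output exceeds the \<open>j\<close>-th function. The enumeration need not be
  effective.\<close>

lemma dominating_halting_times:
  obtains S where "infinite S" "\<And>e. e \<in> S \<Longrightarrow> \<exists>t. halts_by e t"
    "\<And>h. computable h \<Longrightarrow> finite {e \<in> S. \<exists>t<h e. halts_by e t}"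
proof -
  define h where "h = from_nat_into {h. computable h}"
  have "{h. computable h} \<noteq> {}" using computable_id by blast
  then have comp: "computable (h j)" for j
    using from_nat_into[of "{h. computable h}" j] by (simp add: h_def)
  have enum: "\<exists>j. h j = g" if "computable g" for g
    using from_nat_into_surj[OF countable_computable, of g] that by (auto simp: h_def)
  \<comment> \<open>The \<open>Suc\<close> makes the sums strictly increasing in \<open>i\<close>.
    Equal codes would produce equal values, so distinct sums have distinct codes.\<close>
  define H where "H i x = (\<Sum>j\<le>i. Suc (h j x))" for i x
  have "\<exists>p. \<forall>x. run no_oracle p [x] = Some (H i x)" for i
    using computable_sum_fixed[of h i, OF comp] by (simp add: computable_def H_def)
  then obtain p where p: "\<And>i x. run no_oracle (p i) [x] = Some (H i x)" by metis
  define e where "e i = compile (p i)" for i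
  have H_mono: "H i x < H (Suc i) x" for i x by (simp add: H_def)
  have inj: "inj e"
  proof (rule injI)
    fix i j assume "e i = e j"
    then have "reaches (config (ncons (e i) 0) (list_encode [e i])) (config 0 (H i (e i)))"
      "reaches (config (ncons (e i) 0) (list_encode [e i])) (config 0 (H j (e i)))"
      using reaches_compile[OF p] unfolding e_def by metis+
    then obtain m n where "(step ^^ m) (config (ncons (e i) 0) (list_encode [e i])) = config 0 (H i (e i))"
      "(step ^^ n) (config (ncons (e i) 0) (list_encode [e i])) = config 0 (H j (e i))"
      unfolding reaches_def by blast
    then have "H i (e i) = H j (e i)"
      using halts_by_stable[of m _ "max m n"] halts_by_stable[of n _ "max m n"]
      by (metis max.cobounded1 max.cobounded2 pfst_config psnd_config)
    moreover have "strict_mono (\<lambda>i. H i x)" for x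
      using H_mono by (rule strict_monoI_Suc)
    ultimately show "i = j" using strict_mono_eq by blast
  qed
  show ?thesis
  proof (rule that[of "range e"])
    show "infinite (range e)" using inj by (simp add: finite_image_iff)
    show "\<exists>t. halts_by d t" if "d \<in> range e" for d
      using that halts_by_compile(1)[OF p] by (auto simp: e_def)
    fix g assume "computable g"
    then obtain j where j: "h j = g" using enum by blast
    \<comment> \<open>Only the sums before the \<open>j\<close>-th can lack the summand
      \<open>h j = g\<close>.\<close>
    have "{d \<in> range e. \<exists>t<g d. halts_by d t} \<subseteq> e ` {..<j}"
    proof safe
      fix i t assume t: "t < g (e i)" "halts_by (e i) t"
      then have "H i (e i) \<le> t" using halts_by_compile(2)[OF p] by (simp add: e_def)
      moreover have "g (e i) \<le> H i (e i)" if "j \<le> i"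
        using member_le_sum[of j "{..i}" "\<lambda>j. Suc (h j (e i))"] that j by (simp add: H_def)
      ultimately show "e i \<in> e ` {..<j}" using t by (intro imageI) (metis lessThan_iff not_le leD order_trans)
    qed
    then show "finite {d \<in> range e. \<exists>t<g d. halts_by d t}" by (rule finite_subset) simp
  qed
qed

section \<open>Betting on blocks of zeros\<close>

text \<open>In binary, \<open>str_code \<sigma> + 1\<close> is a leading 1 above the bits of
  \<open>\<sigma>\<close>, the first bit lowest. Length and bits can thus be recovered
  arithmetically.\<close>

lemma str_code_Cons: "str_code (b # \<sigma>) + 1 = 2 * (str_code \<sigma> + 1) + of_bool b"
  by simp

lemma str_code_bounds: "2 ^ length \<sigma> \<le> str_code \<sigma> + 1" "str_code \<sigma> + 1 < 2 ^ Suc (length \<sigma>)"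
  by (induction \<sigma>) auto

lemma length_eq_Least: "length \<sigma> = (LEAST l. str_code \<sigma> + 1 < 2 ^ Suc l)"
proof (rule Least_equality[symmetric])
  show "str_code \<sigma> + 1 < 2 ^ Suc (length \<sigma>)" by (rule str_code_bounds)
  fix l assume "str_code \<sigma> + 1 < 2 ^ Suc l"
  with str_code_bounds(1)[of \<sigma>] have "2 ^ length \<sigma> < (2::nat) ^ Suc l" by simp
  then show "length \<sigma> \<le> l" by (simp only: power_strict_increasing_iff[of 2])
qed

lemma nth_eq_odd: "x < length \<sigma> \<Longrightarrow> \<sigma> ! x = odd ((str_code \<sigma> + 1) div 2 ^ x)"
proof (induction \<sigma> arbitrary: x)
  case (Cons b \<sigma>)
  show ?case
  proof (cases x)
    case 0
    then show ?thesis by simp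
  next
    case (Suc y)
    have "(str_code (b # \<sigma>) + 1) div 2 ^ x = (str_code (b # \<sigma>) + 1) div 2 div 2 ^ y"
      by (simp only: Suc power_Suc div_mult2_eq)
    also have "(str_code (b # \<sigma>) + 1) div 2 = str_code \<sigma> + 1"
      unfolding str_code_Cons by simp
    finally show ?thesis using Cons by (simp add: Suc)
  qed
qed simp

definition bet_factor :: "(nat \<Rightarrow> nat \<Rightarrow> bool) \<Rightarrow> nat \<Rightarrow> nat \<Rightarrow> bool \<Rightarrow> nat" where
  "bet_factor W e x b = (if W e x then if b then 0 else 2 else 1)"

definition bet_capital :: "(nat \<Rightarrow> nat \<Rightarrow> bool) \<Rightarrow> nat \<Rightarrow> bool list \<Rightarrow> nat" where
  "bet_capital W e \<sigma> = (\<Prod>x<length \<sigma>. bet_factor W e x (\<sigma> ! x))"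

text \<open>
  Strategy \<open>e\<close> stakes its whole capital on the bit \<open>0\<close> at the positions \<open>x\<close> with \<open>W e x\<close> and has
  weight \<open>2 ^ -(e + 1)\<close> in the mixture. When no strategy bets before position \<open>e\<close>, those with
  \<open>e \<ge> length \<sigma>\<close> still have capital \<open>1\<close>; they contribute the last summand.
\<close>

definition bet_mixture :: "(nat \<Rightarrow> nat \<Rightarrow> bool) \<Rightarrow> bool list \<Rightarrow> real" where
  "bet_mixture W \<sigma> = (\<Sum>e<length \<sigma>. real (bet_capital W e \<sigma>) / 2 ^ Suc e) + 1 / 2 ^ length \<sigma>"

lemma bet_capital_snoc:
  "bet_capital W e (\<sigma> @ [b]) = bet_capital W e \<sigma> * bet_factor W e (length \<sigma>) b"
  by (simp add: bet_capital_def nth_append)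

lemma nonneg_martingale_bet_mixture:
  assumes "\<And>e x. W e x \<Longrightarrow> e \<le> x"
  shows "nonneg_martingale (bet_mixture W)"
  unfolding nonneg_martingale_def
proof (intro allI conjI)
  fix \<sigma>
  show "0 \<le> bet_mixture W \<sigma>" by (simp add: bet_mixture_def sum_nonneg)
  let ?l = "length \<sigma>"
  \<comment> \<open>Strategy \<open>?l\<close> may not bet before position \<open>?l\<close>.
    Lengthening the string therefore splits the tail \<open>1 / 2 ^ ?l\<close> into the share of
    this strategy and an equal new tail.\<close>
  have one: "bet_capital W ?l \<sigma> = 1"
    unfolding bet_capital_def by (rule prod.neutral) (use assms in \<open>force simp: bet_factor_def\<close>)
  have snoc: "bet_mixture W (\<sigma> @ [b]) = (\<Sum>e<?l. real (bet_capital W e \<sigma>) / 2 ^ Suc e * bet_factor W e ?l b)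
      + bet_factor W ?l ?l b / 2 ^ Suc ?l + 1 / 2 ^ Suc ?l" for b
    by (simp add: bet_mixture_def bet_capital_snoc one)
  have two: "real (bet_factor W e x False) + real (bet_factor W e x True) = 2" for e x
    by (simp add: bet_factor_def)
  have "bet_mixture W (\<sigma> @ [False]) + bet_mixture W (\<sigma> @ [True]) =
     (\<Sum>e<?l. real (bet_capital W e \<sigma>) / 2 ^ Suc e * (real (bet_factor W e ?l False) + real (bet_factor W e ?l True)))
     + (real (bet_factor W ?l ?l False) + real (bet_factor W ?l ?l True)) / 2 ^ Suc ?l + 2 / 2 ^ Suc ?l"
    unfolding snoc by (simp add: sum.distrib[symmetric] algebra_simps add_divide_distrib)
  also have "\<dots> = 2 * bet_mixture W \<sigma>"
    unfolding two by (simp add: bet_mixture_def sum_distrib_left field_simps)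
  finally show "bet_mixture W \<sigma> = (bet_mixture W (\<sigma> @ [False]) + bet_mixture W (\<sigma> @ [True])) / 2"
    by simp
qed

text \<open>Rounding the numerator down costs less than 1, that is, less than
  \<open>1 / 2 ^ k\<close> in value.\<close>

lemma real_name_div:
  "real_name (\<lambda>k. 2 ^ k * D div 2 ^ l) (real D / 2 ^ l)"
  unfolding real_name_def
proof
  fix k
  let ?q = "2 ^ k * D div 2 ^ l" and ?r = "2 ^ k * D mod 2 ^ l"
  have "2 ^ k * D = ?q * 2 ^ l + ?r" by (rule div_mult_mod_eq[symmetric])
  then have "2 ^ k * real D = real ?q * 2 ^ l + real ?r"
    by (metis (mono_tags, lifting) of_nat_add of_nat_mult of_nat_numeral of_nat_power)
  then have "real D / 2 ^ l - real ?q / 2 ^ k = real ?r / 2 ^ l / 2 ^ k"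
    by (simp add: field_simps)
  moreover have "real ?r / 2 ^ l \<le> 1"
  proof -
    have "?r < 2 ^ l" by simp
    then have "real ?r < 2 ^ l" by (metis of_nat_less_iff of_nat_numeral of_nat_power)
    then show ?thesis by simp
  qed
  then have "real ?r / 2 ^ l / 2 ^ k \<le> 1 / 2 ^ k" by (intro divide_right_mono) auto
  ultimately show "\<bar>real D / 2 ^ l - real ?q / 2 ^ k\<bar> \<le> 1 / 2 ^ k"
    by simp
qed

text \<open>Over the common denominator \<open>2 ^ length \<sigma>\<close> the numerator is a
  natural number, as \<open>real_name_div\<close> requires.\<close>

lemma bet_mixture_eq:
  "bet_mixture W \<sigma> = real (1 + (\<Sum>e<length \<sigma>. 2 ^ (length \<sigma> - Suc e) * bet_capital W e \<sigma>)) / 2 ^ length \<sigma>"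
proof -
  have "real (2 ^ (length \<sigma> - Suc e) * bet_capital W e \<sigma>) / 2 ^ length \<sigma> = real (bet_capital W e \<sigma>) / 2 ^ Suc e"
    if "e < length \<sigma>" for e
  proof -
    have "(2::real) ^ length \<sigma> = 2 ^ (length \<sigma> - Suc e) * 2 ^ Suc e"
      using that by (subst power_add[symmetric]) (simp del: power_Suc)
    then show ?thesis by simp
  qed
  then show ?thesis
    by (simp add: bet_mixture_def add_divide_distrib sum_divide_distrib del: power_Suc)
qed

lemma computable_bet_mixture:
  assumes W: "decidable (\<lambda>z. W (pfst z) (psnd z))" and "\<And>e x. W e x \<Longrightarrow> e \<le> x"
  shows "\<exists>g. computable g \<and> martingale_name g (bet_mixture W)"
proof -
  define len where "len z = (LEAST l. z + 1 < 2 ^ Suc l)" for z :: nat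
  have len: "computable len" unfolding len_def
  proof (rule computable_Least)
    show "decidable (\<lambda>z. pfst z + 1 < 2 ^ Suc (psnd z))" by (intro computable_intros)
    show "\<exists>y. x + 1 < 2 ^ Suc y" for x :: nat
      using less_exp[of "Suc x"] by (intro exI[of _ x]) simp
  qed
  \<comment> \<open>The capital computed from the code alone: position \<open>x\<close> of the
    string is bit \<open>x\<close> of \<open>z + 1\<close>.\<close>
  define cap where "cap e z = (\<Prod>x<len z. (if W e x then if odd ((z + 1) div 2 ^ x) then 0 else 2 else (1::nat)))" for e z :: nat
  define g where "g w = 2 ^ psnd w * (1 + (\<Sum>e<len (pfst w). 2 ^ (len (pfst w) - Suc e) * cap e (pfst w)))
     div 2 ^ len (pfst w)" for w
  have W': "decidable (\<lambda>z. W (h z) (h' z))" if "computable h" "computable h'" for h h'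
    using computable_comp[OF W[unfolded decidable_def] computable_encode[OF that]] by (simp add: decidable_def)
  have cap: "computable (\<lambda>z. cap (h z) (h' z))" if "computable h" "computable h'" for h h'
    unfolding cap_def
    by (intro computable_intros W' computable_div computable_comp[OF that(1)] computable_comp[OF that(2)]
        computable_comp[OF len] that) simp
  have "computable g" unfolding g_def
    by (intro computable_intros cap computable_div computable_comp[OF len]) simp
  moreover have "martingale_name g (bet_mixture W)"
    unfolding martingale_name_def
  proof (intro conjI allI)
    show "nonneg_martingale (bet_mixture W)" by (rule nonneg_martingale_bet_mixture) fact
    fix \<sigma>
    have len_code: "len (str_code \<sigma>) = length \<sigma>" by (simp only: len_def length_eq_Least)
    have "cap e (str_code \<sigma>) = bet_capital W e \<sigma>" for e
      unfolding cap_def bet_capital_def len_code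
      by (rule prod.cong) (simp_all add: bet_factor_def nth_eq_odd)
    then have "(\<lambda>k. g (prod_encode (str_code \<sigma>, k))) =
        (\<lambda>k. 2 ^ k * (1 + (\<Sum>e<length \<sigma>. 2 ^ (length \<sigma> - Suc e) * bet_capital W e \<sigma>)) div 2 ^ length \<sigma>)"
      unfolding g_def by (simp only: pfst_encode psnd_encode len_code)
    then show "real_name (\<lambda>k. g (prod_encode (str_code \<sigma>, k))) (bet_mixture W \<sigma>)"
      unfolding bet_mixture_eq by (simp only: real_name_div)
  qed
  ultimately show ?thesis by blast
qed

lemma length_prefix [simp]: "length (prefix \<alpha> n) = n"
  and nth_prefix [simp]: "x < n \<Longrightarrow> prefix \<alpha> n ! x = \<alpha> x"
  by (simp_all add: prefix_def)

text \<open>When all its bets have been made and won, strategy \<open>e\<close> has doubled its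
  capital once per bet; its weighted summand alone gives the bound.\<close>

lemma bet_mixture_ge:
  assumes "finite {x. W e x}" "\<And>x. W e x \<Longrightarrow> \<not> \<alpha> x" "e < n" "\<And>x. W e x \<Longrightarrow> x < n"
  shows "2 ^ card {x. W e x} / 2 ^ Suc e \<le> bet_mixture W (prefix \<alpha> n)"
proof -
  have "bet_capital W e (prefix \<alpha> n) = (\<Prod>x<n. if x \<in> {x. W e x} then 2 else 1)"
    unfolding bet_capital_def length_prefix
    by (rule prod.cong) (use assms(2) in \<open>auto simp: bet_factor_def\<close>)
  also have "\<dots> = (\<Prod>x\<in>{..<n} \<inter> {x. W e x}. 2)"
    by (rule prod.inter_restrict[symmetric]) simp
  also have "{..<n} \<inter> {x. W e x} = {x. W e x}" using assms(4) by auto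
  finally have "real (bet_capital W e (prefix \<alpha> n)) = 2 ^ card {x. W e x}" by simp
  then have "2 ^ card {x. W e x} / 2 ^ Suc e = real (bet_capital W e (prefix \<alpha> n)) / 2 ^ Suc e" by simp
  also have "\<dots> \<le> (\<Sum>e<n. real (bet_capital W e (prefix \<alpha> n)) / 2 ^ Suc e)"
    using assms(3) by (intro member_le_sum) auto
  also have "\<dots> \<le> bet_mixture W (prefix \<alpha> n)" by (simp add: bet_mixture_def)
  finally show ?thesis .
qed

text \<open>More than \<open>e + M\<close> winning bets outweigh the factor
  \<open>1 / 2 ^ Suc e\<close> by \<open>2 ^ M\<close>, on all sufficiently long prefixes, so the
  capital tends to infinity. The martingale does not consult the oracle, hence
  \<open>\<beta>\<close> is arbitrary.\<close>

lemma not_comp_random_unifI: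
  assumes "decidable (\<lambda>z. W (pfst z) (psnd z))" and le: "\<And>e x. W e x \<Longrightarrow> e \<le> x"
    and win: "\<And>M. \<exists>e. finite {x. W e x} \<and> e + M < card {x. W e x} \<and> (\<forall>x. W e x \<longrightarrow> \<not> \<alpha> x)"
  shows "\<not> comp_random_unif \<alpha> \<beta>"
proof -
  obtain g where g: "computable g" "martingale_name g (bet_mixture W)"
    using computable_bet_mixture[OF assms(1) le] by blast
  have "(\<lambda>n. ereal (bet_mixture W (prefix \<alpha> n))) \<longlonglongrightarrow> \<infinity>"
    unfolding tendsto_PInfty eventually_sequentially
  proof
    fix r :: real
    obtain M :: nat where M: "r < real M" using reals_Archimedean2 by blast
    obtain e where e: "finite {x. W e x}" "e + M < card {x. W e x}" "\<forall>x. W e x \<longrightarrow> \<not> \<alpha> x"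
      using win by blast
    obtain b where b: "\<And>x. W e x \<Longrightarrow> x < b" using e(1) unfolding finite_nat_set_iff_bounded by auto
    have "r < bet_mixture W (prefix \<alpha> n)" if n: "max (Suc e) b \<le> n" for n
    proof -
      have "real M < 2 ^ M" by (rule of_nat_less_two_power)
      also have "(2::real) ^ M * 2 ^ Suc e \<le> 2 ^ card {x. W e x}"
        unfolding power_add[symmetric] using e(2) by (intro power_increasing) auto
      then have "(2::real) ^ M \<le> 2 ^ card {x. W e x} / 2 ^ Suc e" by (simp add: field_simps)
      also have "\<dots> \<le> bet_mixture W (prefix \<alpha> n)"
        using e b n by (intro bet_mixture_ge) (auto dest!: b)
      finally show ?thesis using M by simp
    qed
    then show "\<exists>N. \<forall>n\<ge>N. ereal r < ereal (bet_mixture W (prefix \<alpha> n))"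
      by (intro exI[of _ "max (Suc e) b"]) simp
  qed
  then have "limsup (\<lambda>n. ereal (bet_mixture W (prefix \<alpha> n))) = \<infinity>"
    by (rule lim_imp_Limsup[rotated]) simp
  moreover have "computable_map (\<lambda>_. g)" using g(1) by (rule computable_map_const)
  ultimately show ?thesis unfolding comp_random_unif_def using g(2)
    by (intro notI, elim notE) (rule exI[of _ "\<lambda>_. g"], rule exI[of _ "\<lambda>_. bet_mixture W"], simp)
qed

text \<open>Membership of \<open>x\<close> inspects only positions and machine steps up to
  \<open>x\<close>, so it is decidable although halting is not. A program that never halts has an
  empty block.\<close>

definition block :: "(nat \<Rightarrow> bool) \<Rightarrow> nat \<Rightarrow> nat set" where
  "block A e = {x. A x \<and> halts_by e x \<and> card {y. y < x \<and> A y \<and> halts_by e y} < 3 * e}"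

section \<open>Ranks and sizes of blocks\<close>

lemma rank_less:
  fixes x y :: nat
  assumes "P x" "x < y"
  shows "card {z. z < x \<and> P z} < card {z. z < y \<and> P z}"
  by (rule psubset_card_mono) (use assms in auto)

lemma inj_on_rank: "inj_on (\<lambda>x::nat. card {z. z < x \<and> P z}) {x. P x}"
proof (rule inj_onI)
  fix x y :: nat
  assume "x \<in> {x. P x}" "y \<in> {x. P x}" "card {z. z < x \<and> P z} = card {z. z < y \<and> P z}"
  then show "x = y" using rank_less[of P x y] rank_less[of P y x] by (cases x y rule: linorder_cases) auto
qed

text \<open>The rank among the eligible positions is injective and stays below \<open>3 * e\<close>
  on the block.\<close>

lemma finite_block: "finite (block A e)"
  and card_block_le: "card (block A e) \<le> 3 * e"
proof -
  let ?r = "\<lambda>x. card {y. y < x \<and> A y \<and> halts_by e y}"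
  have inj: "inj_on ?r (block A e)"
    using inj_on_rank[of "\<lambda>y. A y \<and> halts_by e y"] by (rule inj_on_subset) (auto simp: block_def)
  have sub: "?r ` block A e \<subseteq> {..<3 * e}" by (auto simp: block_def)
  show "finite (block A e)" using inj sub by (meson finite_imageD finite_lessThan finite_subset)
  show "card (block A e) \<le> 3 * e" using card_inj_on_le[OF inj sub] by simp
qed

text \<open>Once \<open>e\<close> has halted, every later member of \<open>A\<close> is eligible.
  There are infinitely many, so each rank below \<open>3 * e\<close> is attained.\<close>

lemma card_block:
  assumes "infinite {x. A x}" "halts_by e t"
  shows "card (block A e) = 3 * e"
proof -
  let ?G = "{x. A x \<and> halts_by e x}"
  have "{x. A x} \<subseteq> ?G \<union> {..<t}" using halts_by_mono[OF assms(2)] by (auto simp: not_less)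
  then have inf: "infinite ?G" using assms(1) by (meson finite_Un finite_lessThan finite_subset)
  have rank: "{y. y < enumerate ?G i \<and> A y \<and> halts_by e y} = enumerate ?G ` {..<i}" for i
  proof safe
    fix y assume y: "y < enumerate ?G i" "A y" "halts_by e y"
    then obtain j where "y = enumerate ?G j" using enumerate_Ex[of ?G y] inf by auto
    then show "y \<in> enumerate ?G ` {..<i}" using y inf by (auto simp: enumerate_mono_iff)
  next
    fix j assume "j < i"
    then show "enumerate ?G j < enumerate ?G i" using inf by (rule enumerate_mono)
    show "A (enumerate ?G j)" "halts_by e (enumerate ?G j)" using enumerate_in_set[OF inf, of j] by auto
  qed
  have inj: "inj (enumerate ?G)" using strict_mono_enumerate[OF inf] by (rule strict_mono_imp_inj_on)
  then have "card {y. y < enumerate ?G i \<and> A y \<and> halts_by e y} = i" for i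
    unfolding rank by (simp add: card_image inj_on_subset)
  then have "enumerate ?G ` {..<3 * e} \<subseteq> block A e"
    using enumerate_in_set[OF inf] by (auto simp: block_def)
  from card_mono[OF finite_block this] have "3 * e \<le> card (block A e)"
    using inj by (simp add: card_image inj_on_subset)
  then show ?thesis using card_block_le[of A e] by simp
qed

lemma decidable_block:
  assumes "decidable A"
  shows "decidable (\<lambda>z. psnd z \<in> block A (pfst z))"
proof -
  have A: "decidable (\<lambda>z. A (h z))" if "computable h" for h
    using computable_comp[OF assms[unfolded decidable_def] that] by (simp add: decidable_def)
  have H: "decidable (\<lambda>z. halts_by (h z) (h' z))" if "computable h" "computable h'" for h h'
    using computable_comp[OF decidable_halts_by[unfolded decidable_def] computable_encode[OF that]]
    by (simp add: decidable_def)
  show ?thesis unfolding block_def mem_Collect_eq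
    by (intro computable_intros A H)
qed

section \<open>Betting on the blocks after dropping rows\<close>

lemma join_from_eq: "join_from n \<omega> x = join \<omega> (prod_encode (n + pfst x, psnd x))"
  by (simp add: join_from_def join_def pfst_def psnd_def split: prod.split)

text \<open>Dropping rows renumbers positions by an injection \<open>c\<close>. Of the
  \<open>3 * e\<close> positions in a block this loses those in the first \<open>n\<close> rows,
  whose number is bounded independently of \<open>e\<close>, and at most \<open>e\<close> positions
  violating \<open>e \<le> x\<close>. About \<open>2 * e\<close> bets remain to beat the weight
  \<open>1 / 2 ^ Suc e\<close>.\<close>

lemma not_ecu_randomI:
  assumes A: "decidable A" "infinite {x. A x}" and rows: "\<And>n. finite {x. A x \<and> pfst x < n}"
    and S: "infinite S" "\<And>e. e \<in> S \<Longrightarrow> \<exists>t. halts_by e t"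
    and zero: "\<And>e x. e \<in> S \<Longrightarrow> x \<in> block A e \<Longrightarrow> \<not> join \<omega> x"
  shows "\<not> ecu_random \<omega>"
  unfolding ecu_random_def
proof (intro notI, elim exE)
  fix n
  define c where "c x = prod_encode (n + pfst x, psnd x)" for x
  define W where "W e x \<longleftrightarrow> e \<le> x \<and> c x \<in> block A e" for e x
  have inj: "inj c" by (rule injI) (metis c_def add_left_cancel pfst_encode psnd_encode prod_encode_pfst_psnd)
  have "\<not> comp_random_unif (join_from n \<omega>) (join_upto n \<omega>)"
  proof (rule not_comp_random_unifI)
    show "decidable (\<lambda>z. W (pfst z) (psnd z))"
      unfolding W_def
      using computable_comp[OF decidable_block[OF A(1), unfolded decidable_def],
          of "\<lambda>z. prod_encode (pfst z, c (psnd z))"]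
      by (intro computable_intros) (simp add: decidable_def c_def computable_intros)
    show "e \<le> x" if "W e x" for e x using that by (simp add: W_def)
    fix M
    let ?K = "{x. A x \<and> pfst x < n}"
    \<comment> \<open>This choice makes the at least \<open>2 * e - card ?K\<close> remaining bets
      exceed \<open>e + M\<close>.\<close>
    obtain e where e: "e \<in> S" "card ?K + M < e" using S(1) infinite_nat_iff_unbounded by blast
    obtain t where t: "halts_by e t" using S(2) e(1) by blast
    have "c ` {x. W e x} \<subseteq> block A e" by (auto simp: W_def)
    then have fin: "finite {x. W e x}"
      using inj by (meson finite_block finite_imageD finite_subset inj_on_subset subset_UNIV)
    have "block A e \<subseteq> ?K \<union> c ` {..<e} \<union> c ` {x. W e x}"
    proof
      fix y assume y: "y \<in> block A e"
      show "y \<in> ?K \<union> c ` {..<e} \<union> c ` {x. W e x}"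
      proof (cases "pfst y < n")
        case True
        then show ?thesis using y by (simp add: block_def)
      next
        case False
        then have "y = c (prod_encode (pfst y - n, psnd y))" by (simp add: c_def)
        with y show ?thesis unfolding W_def by (metis (mono_tags, lifting) UnI1 UnI2 image_eqI lessThan_iff mem_Collect_eq not_le)
      qed
    qed
    then have "card (block A e) \<le> card (?K \<union> c ` {..<e} \<union> c ` {x. W e x})"
      by (rule card_mono[rotated]) (use rows fin in auto)
    also have "\<dots> \<le> card (?K \<union> c ` {..<e}) + card (c ` {x. W e x})"
      by (rule card_Un_le)
    also have "card (?K \<union> c ` {..<e}) \<le> card ?K + card (c ` {..<e})"
      by (rule card_Un_le)
    finally have "card (block A e) \<le> card ?K + card (c ` {..<e}) + card (c ` {x. W e x})"
      by simp
    moreover have "card (c ` {..<e}) = e" "card (c ` {x. W e x}) = card {x. W e x}"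
      using inj by (simp_all add: card_image inj_on_subset)
    ultimately have "e + M < card {x. W e x}" using e(2) card_block[OF A(2) t] by simp
    moreover have "\<not> join_from n \<omega> x" if "W e x" for x
      using zero[OF e(1)] that by (simp add: join_from_eq W_def c_def)
    ultimately show "\<exists>e. finite {x. W e x} \<and> e + M < card {x. W e x} \<and> (\<forall>x. W e x \<longrightarrow> \<not> join_from n \<omega> x)"
      using fin by blast
  qed
  moreover assume "comp_random_unif (join_from n \<omega>) (join_upto n \<omega>)"
  ultimately show False by contradiction
qed

section \<open>Fair coins and Ville's inequality\<close>

text \<open>Domination is applied to \<open>h e\<close>, the sum of all \<open>N m\<close> with
  \<open>m \<le> q e\<close>. Outside a finite set \<open>R\<close>, the block of \<open>e\<close>
  lies at or beyond \<open>h e\<close>, so it meets \<open>{..<N m}\<close> only if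
  \<open>q e < m\<close>. Such blocks have at most \<open>m\<close> elements altogether, and
  \<open>R\<close> accounts for the constant.\<close>

lemma card_blocks_bounded:
  assumes dom: "\<And>h. computable h \<Longrightarrow> finite {e \<in> S. \<exists>t<h e. halts_by e t}" and N: "computable N"
  shows "\<exists>C. \<forall>m. card ({..<N m} \<inter> (\<Union>e\<in>S. block A e)) \<le> C + m"
proof -
  define q where "q e = (\<Sum>i<Suc e. 3 * i)" for e :: nat
  define h where "h e = (\<Sum>m<Suc (q e). N m)" for e
  have "computable h" unfolding h_def q_def
    by (intro computable_intros computable_comp[OF N])
  define R where "R = {e \<in> S. \<exists>t<h e. halts_by e t}"
  have R: "finite R" unfolding R_def by (rule dom) fact
  have "e \<le> q e" for e by (simp add: q_def)
  then have fin: "finite {e. q e < m}" for m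
    by (rule_tac finite_subset[of _ "{..<m}"]) (auto intro: le_less_trans)
  \<comment> \<open>\<open>q M\<close> already adds up the sizes \<open>3 * e\<close> for all
    \<open>e\<close> up to the largest \<open>M\<close> with \<open>q M < m\<close>.\<close>
  have small: "(\<Sum>e\<in>{e. q e < m}. 3 * e) \<le> m" for m
  proof (cases "{e. q e < m} = {}")
    case False
    define M where "M = Max {e. q e < m}"
    have M: "q M < m" using Max_in[OF fin False] by (simp add: M_def)
    have "{e. q e < m} \<subseteq> {..<Suc M}"
      using Max_ge[OF fin, of _ m] by (auto simp: M_def less_Suc_eq_le)
    then have "(\<Sum>e\<in>{e. q e < m}. 3 * e) \<le> q M"
      unfolding q_def by (intro sum_mono2) auto
    then show ?thesis using M by simp
  qed simp
  have "card ({..<N m} \<inter> (\<Union>e\<in>S. block A e)) \<le> (\<Sum>e\<in>R. 3 * e) + m" for m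
  proof -
    have "{..<N m} \<inter> (\<Union>e\<in>S. block A e) \<subseteq> (\<Union>e\<in>R \<union> {e. q e < m}. block A e)"
    proof safe
      fix x e assume x: "x < N m" "e \<in> S" "x \<in> block A e"
      have "e \<in> R" if "m \<le> q e"
      proof -
        have "N m \<le> h e" unfolding h_def using that by (intro member_le_sum) auto
        then have "x < h e" using x(1) by simp
        moreover have "halts_by e x" using x(3) by (simp add: block_def)
        ultimately show ?thesis using x(2) unfolding R_def by blast
      qed
      then show "x \<in> (\<Union>e\<in>R \<union> {e. q e < m}. block A e)" using x(3) by (cases "m \<le> q e") auto
    qed
    then have "card ({..<N m} \<inter> (\<Union>e\<in>S. block A e)) \<le> card (\<Union>e\<in>R \<union> {e. q e < m}. block A e)"
      by (rule card_mono[rotated]) (use R fin finite_block in auto)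
    also have "\<dots> \<le> (\<Sum>e\<in>R \<union> {e. q e < m}. card (block A e))"
      using R fin by (intro card_UN_le) auto
    also have "\<dots> \<le> (\<Sum>e\<in>R \<union> {e. q e < m}. 3 * e)"
      by (intro sum_mono card_block_le)
    also have "\<dots> \<le> (\<Sum>e\<in>R. 3 * e) + (\<Sum>e\<in>{e. q e < m}. 3 * e)"
      using sum.union_inter[OF R fin, of "\<lambda>e. 3 * e" m] by linarith
    also have "\<dots> \<le> (\<Sum>e\<in>R. 3 * e) + m" using small by simp
    finally show ?thesis .
  qed
  then show ?thesis by blast
qed

section \<open>The fair-coin measure and prefix events\<close>

interpretation fair_bits: product_prob_space "\<lambda>_::nat. measure_pmf (bernoulli_pmf (1 / 2))" UNIV
  by unfold_locales

interpretation coin: prob_space coin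
  unfolding coin_def by (rule prob_space_PiM) (rule prob_space_measure_pmf)

lemma space_coin [simp]: "space coin = UNIV"
  by (simp add: coin_def space_PiM)

lemma measurable_coin_component [measurable]: "(\<lambda>x. x c) \<in> measurable coin (count_space UNIV)"
proof -
  have "(\<lambda>x. x c) \<in> measurable coin (measure_pmf (bernoulli_pmf (1 / 2)))"
    unfolding coin_def by (rule measurable_component_singleton) simp
  then show ?thesis by simp
qed

lemma measure_coin_fixed:
  assumes "finite J"
  shows "measure coin {x. \<forall>j\<in>J. x j = a j} = 1 / 2 ^ card J"
proof -
  have "emeasure coin {x \<in> space coin. \<forall>j\<in>J. x j \<in> {a j}} =
      (\<Prod>j\<in>J. emeasure (measure_pmf (bernoulli_pmf (1 / 2))) {a j})"
    unfolding coin_def using assms by (intro fair_bits.emeasure_PiM_Collect) auto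
  also have "\<dots> = (\<Prod>j\<in>J. ennreal (1 / 2))"
    by (intro prod.cong refl) (simp add: emeasure_pmf_single)
  also have "\<dots> = ennreal (1 / 2) ^ card J" by (rule prod_constant)
  also have "\<dots> = ennreal ((1 / 2) ^ card J)" by (rule ennreal_power) simp
  also have "\<dots> = ennreal (1 / 2 ^ card J)" by (simp only: power_one_over)
  finally show ?thesis by (simp add: measure_def)
qed

lemma prefix_eq_iff: "length \<sigma> = n \<Longrightarrow> prefix x n = \<sigma> \<longleftrightarrow> (\<forall>i<n. x i = \<sigma> ! i)"
  by (auto simp: list_eq_iff_nth_eq)

lemma take_prefix: "take L (prefix x n) = prefix x (min L n)"
  by (simp add: prefix_def take_map min_def)

lemma prefix_mem_measurable:
  assumes "\<And>c. (\<lambda>p. G p c) \<in> measurable M (count_space UNIV)"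
  shows "{p \<in> space M. prefix (G p) n \<in> S} \<in> sets M"
proof -
  have [measurable]: "(\<lambda>p. G p c) \<in> measurable M (count_space UNIV)" for c by (rule assms)
  have "{p \<in> space M. \<forall>i<n. G p i = \<sigma> ! i} \<in> sets M" for \<sigma> by measurable
  then have "(\<Union>\<sigma>\<in>{\<sigma>\<in>S. length \<sigma> = n}. {p \<in> space M. \<forall>i<n. G p i = \<sigma> ! i}) \<in> sets M"
    by (intro sets.countable_UN'') auto
  also have "(\<Union>\<sigma>\<in>{\<sigma>\<in>S. length \<sigma> = n}. {p \<in> space M. \<forall>i<n. G p i = \<sigma> ! i}) = {p \<in> space M. prefix (G p) n \<in> S}"
    by (auto simp: prefix_eq_iff[symmetric])
  finally show ?thesis .
qed

lemma finite_strings: "finite {\<sigma> :: bool list. length \<sigma> = n}"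
  and card_strings: "card {\<sigma> :: bool list. length \<sigma> = n} = 2 ^ n"
  using finite_lists_length_eq[of "UNIV :: bool set" n] card_lists_length_eq[of "UNIV :: bool set" n]
  by simp_all

lemma measure_prefix_mem:
  assumes G: "\<And>c. (\<lambda>p. G p c) \<in> measurable M (count_space UNIV)" and "finite_measure M"
    and S: "S \<subseteq> {\<sigma>. length \<sigma> = n}"
  shows "measure M {p \<in> space M. prefix (G p) n \<in> S} = (\<Sum>\<sigma>\<in>S. measure M {p \<in> space M. \<forall>i<n. G p i = \<sigma> ! i})"
proof -
  interpret finite_measure M by fact
  have "{p \<in> space M. prefix (G p) n \<in> S} = (\<Union>\<sigma>\<in>S. {p \<in> space M. prefix (G p) n \<in> {\<sigma>}})"
    by auto
  also have "measure M \<dots> = (\<Sum>\<sigma>\<in>S. measure M {p \<in> space M. prefix (G p) n \<in> {\<sigma>}})"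
  proof (rule finite_measure_finite_Union)
    show "finite S" using S finite_strings by (rule finite_subset)
    show "(\<lambda>\<sigma>. {p \<in> space M. prefix (G p) n \<in> {\<sigma>}}) ` S \<subseteq> sets M"
      using prefix_mem_measurable[of G M, OF G] by blast
  qed (auto simp: disjoint_family_on_def)
  also have "\<dots> = (\<Sum>\<sigma>\<in>S. measure M {p \<in> space M. \<forall>i<n. G p i = \<sigma> ! i})"
    using S by (intro sum.cong refl) (auto simp: prefix_eq_iff intro!: arg_cong[where f="measure M"])
  finally show ?thesis .
qed

text \<open>Injectivity of \<open>g\<close> makes the listed bits independent, so all
  \<open>2 ^ n\<close> patterns are equally likely. This covers subsequences such as the bits at the
  indices in \<open>B_set f\<close>.\<close>

lemma measure_coin_prefix_mem:
  assumes "inj g" "S \<subseteq> {\<sigma>. length \<sigma> = n}"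
  shows "measure coin {x. prefix (\<lambda>i. x (g i)) n \<in> S} = card S / 2 ^ n"
proof -
  have "measure coin {x. \<forall>i<n. x (g i) = \<sigma> ! i} = 1 / 2 ^ n" for \<sigma>
  proof -
    have "{x. \<forall>i<n. x (g i) = \<sigma> ! i} = {x. \<forall>j\<in>g ` {..<n}. x j = \<sigma> ! inv g j}"
      using assms(1) by auto
    then show ?thesis
      using measure_coin_fixed[of "g ` {..<n}" "\<lambda>j. \<sigma> ! inv g j"] assms(1)
      by (simp add: card_image inj_on_subset)
  qed
  then show ?thesis
    using measure_prefix_mem[of "\<lambda>x i. x (g i)" coin S n] assms(2) coin.finite_measure_axioms
    by simp
qed

text \<open>Ville's inequality as a count of strings, by induction on the length. If the capital has
  already reached \<open>c\<close>, all \<open>2 ^ n\<close> strings may count; otherwise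
  \<open>c\<close> is reached within one of the two subtrees, whose bounds add up by the martingale
  equation.\<close>

lemma ville_count:
  fixes c :: real
  assumes d: "nonneg_martingale d" and "c > 0"
  shows "card {\<tau>. length \<tau> = n \<and> (\<exists>j\<le>n. c \<le> d (\<sigma> @ take j \<tau>))} * c \<le> 2 ^ n * d \<sigma>"
proof (induction n arbitrary: \<sigma>)
  case 0
  have "0 \<le> d \<sigma>" using d by (auto simp: nonneg_martingale_def)
  moreover have "{\<tau>. length \<tau> = 0 \<and> (\<exists>j\<le>0. c \<le> d (\<sigma> @ take j \<tau>))} = (if c \<le> d \<sigma> then {[]} else {})"
    by auto
  ultimately show ?case by simp
next
  case (Suc n)
  let ?X = "\<lambda>n \<sigma>. {\<tau>. length \<tau> = n \<and> (\<exists>j\<le>n. c \<le> d (\<sigma> @ take j \<tau>))}"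
  have fin: "finite (?X n \<sigma>)" for n \<sigma> by (rule finite_subset[OF _ finite_strings[of n]]) auto
  show ?case
  proof (cases "c \<le> d \<sigma>")
    case True
    have "card (?X (Suc n) \<sigma>) \<le> card {\<tau> :: bool list. length \<tau> = Suc n}"
      by (rule card_mono) (auto simp: finite_strings)
    then have "real (card (?X (Suc n) \<sigma>)) \<le> 2 ^ Suc n"
      unfolding card_strings of_nat_le_iff[where 'a=real, symmetric] by (simp only: of_nat_power of_nat_numeral)
    then have "real (card (?X (Suc n) \<sigma>)) * c \<le> 2 ^ Suc n * c"
      by (rule mult_right_mono) (rule less_imp_le[OF \<open>c > 0\<close>])
    also have "\<dots> \<le> 2 ^ Suc n * d \<sigma>"
      by (rule mult_left_mono[OF True]) simp
    finally show ?thesis .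
  next
    case False
    have "?X (Suc n) \<sigma> \<subseteq> (#) False ` ?X n (\<sigma> @ [False]) \<union> (#) True ` ?X n (\<sigma> @ [True])"
    proof safe
      fix \<tau> j assume \<tau>: "length \<tau> = Suc n" "j \<le> Suc n" "c \<le> d (\<sigma> @ take j \<tau>)"
        and not: "\<tau> \<notin> (#) True ` ?X n (\<sigma> @ [True])"
      obtain b \<tau>' where b: "\<tau> = b # \<tau>'" using \<tau>(1) by (cases \<tau>) auto
      obtain i where i: "j = Suc i" using \<tau>(3) False by (cases j) auto
      have "\<tau>' \<in> ?X n (\<sigma> @ [b])" using \<tau> b i by auto
      then show "\<tau> \<in> (#) False ` ?X n (\<sigma> @ [False])" using b not by (cases b) auto
    qed
    then have "card (?X (Suc n) \<sigma>) \<le> card ((#) False ` ?X n (\<sigma> @ [False]) \<union> (#) True ` ?X n (\<sigma> @ [True]))"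
      by (rule card_mono[rotated]) (intro finite_UnI finite_imageI fin)
    also have "\<dots> \<le> card ((#) False ` ?X n (\<sigma> @ [False])) + card ((#) True ` ?X n (\<sigma> @ [True]))"
      by (rule card_Un_le)
    also have "\<dots> = card (?X n (\<sigma> @ [False])) + card (?X n (\<sigma> @ [True]))"
      by (simp add: card_image)
    finally have "card (?X (Suc n) \<sigma>) * c \<le> (card (?X n (\<sigma> @ [False])) + card (?X n (\<sigma> @ [True]))) * c"
      using \<open>c > 0\<close> by (intro mult_right_mono) auto
    also have "\<dots> \<le> 2 ^ n * d (\<sigma> @ [False]) + 2 ^ n * d (\<sigma> @ [True])"
      using Suc.IH[of "\<sigma> @ [False]"] Suc.IH[of "\<sigma> @ [True]"] by (simp add: ring_distribs)
    also have "\<dots> = 2 ^ Suc n * d \<sigma>"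
    proof -
      have "d \<sigma> = (d (\<sigma> @ [False]) + d (\<sigma> @ [True])) / 2"
        using d unfolding nonneg_martingale_def by blast
      then have "d (\<sigma> @ [False]) + d (\<sigma> @ [True]) = 2 * d \<sigma>" by simp
      then show ?thesis by (simp add: distrib_left[symmetric])
    qed
    finally show ?thesis .
  qed
qed

text \<open>Ville's bound \<open>d [] / real (Suc c)\<close> holds for every finite horizon and
  passes to the increasing union. Letting \<open>c\<close> grow leaves a null set.\<close>

lemma AE_martingale_bounded:
  assumes d: "nonneg_martingale d" and g: "inj g"
  shows "AE x in coin. limsup (\<lambda>n. ereal (d (prefix (\<lambda>i. x (g i)) n))) \<noteq> \<infinity>"
proof -
  define E where "E c n = {x. \<exists>j\<le>n. real (Suc c) \<le> d (prefix (\<lambda>i. x (g i)) j)}" for c n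
  let ?S = "\<lambda>c n. {\<tau>. length \<tau> = n \<and> (\<exists>j\<le>n. real (Suc c) \<le> d ([] @ take j \<tau>))}"
  have E_eq: "E c n = {x \<in> space coin. prefix (\<lambda>i. x (g i)) n \<in> ?S c n}" for c n
    unfolding E_def by (auto simp: take_prefix min_absorb1) 
  have E_sets: "E c n \<in> sets coin" for c n
    unfolding E_eq by (rule prefix_mem_measurable) simp
  have E_le: "measure coin (E c n) \<le> d [] / real (Suc c)" for c n
  proof -
    have "measure coin (E c n) = card (?S c n) / 2 ^ n"
      unfolding E_eq using measure_coin_prefix_mem[OF g, of "?S c n" n] by auto
    also have "\<dots> \<le> d [] / real (Suc c)"
      using ville_count[OF d, of "real (Suc c)" n "[]"] by (simp add: field_simps)
    finally show ?thesis .
  qed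
  define B where "B = (\<Inter>c. \<Union>n. E c n)"
  have B_sets: "B \<in> sets coin" unfolding B_def using E_sets by blast
  have "measure coin B \<le> d [] / real (Suc c)" for c
  proof -
    have "incseq (E c)" by (rule incseq_SucI) (auto simp: E_def intro: le_SucI)
    then have "(\<lambda>n. measure coin (E c n)) \<longlonglongrightarrow> measure coin (\<Union>n. E c n)"
      using E_sets by (intro coin.finite_Lim_measure_incseq) auto
    then have "measure coin (\<Union>n. E c n) \<le> d [] / real (Suc c)"
      by (rule LIMSEQ_le_const2) (use E_le in blast)
    moreover have "measure coin B \<le> measure coin (\<Union>n. E c n)"
      unfolding B_def using E_sets by (intro coin.finite_measure_mono) auto
    ultimately show ?thesis by simp
  qed
  moreover have "(\<lambda>c. d [] / real (Suc c)) \<longlonglongrightarrow> 0" by real_asymp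
  ultimately have "measure coin B \<le> 0" by (intro LIMSEQ_le_const) auto
  then have "B \<in> null_sets coin" using B_sets measure_nonneg[of coin B]
    by (simp add: null_sets_def coin.emeasure_eq_measure)
  moreover have "x \<in> B" if "limsup (\<lambda>n. ereal (d (prefix (\<lambda>i. x (g i)) n))) = \<infinity>" for x
  proof (rule ccontr)
    assume "x \<notin> B"
    then obtain c where "\<And>n. d (prefix (\<lambda>i. x (g i)) n) < real (Suc c)"
      unfolding B_def E_def by (auto simp: not_le)
    then have "limsup (\<lambda>n. ereal (d (prefix (\<lambda>i. x (g i)) n))) \<le> ereal (real (Suc c))"
      by (intro Limsup_bounded always_eventually allI) (simp add: less_imp_le)
    with that show False by simp
  qed
  ultimately show ?thesis by (intro AE_I'[of B]) auto
qed

text \<open>For a fixed oracle, a computable map thus names at most one martingale, which keeps the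
  family of martingales to be defeated countable.\<close>

lemma real_name_unique:
  assumes "real_name g x" "real_name g y"
  shows "x = y"
proof -
  have "\<bar>x - y\<bar> \<le> 2 / 2 ^ k" for k
  proof -
    have "\<bar>x - real (g k) / 2 ^ k\<bar> \<le> 1 / 2 ^ k" "\<bar>y - real (g k) / 2 ^ k\<bar> \<le> 1 / 2 ^ k"
      using assms unfolding real_name_def by blast+
    then have "\<bar>x - y\<bar> \<le> 1 / 2 ^ k + 1 / 2 ^ k" by linarith
    then show ?thesis by simp
  qed
  moreover have "(\<lambda>k. 2 / 2 ^ k :: real) \<longlonglongrightarrow> 0" by real_asymp
  ultimately have "\<bar>x - y\<bar> \<le> 0" by (intro LIMSEQ_le_const) auto
  then show ?thesis by simp
qed

lemma countable_computable_map: "countable {\<Phi>. computable_map \<Phi>}"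
proof -
  have "{\<Phi>. computable_map \<Phi>} \<subseteq> range (\<lambda>p \<gamma> x. the (run \<gamma> p [x]))"
  proof safe
    fix \<Phi> assume "computable_map \<Phi>"
    then obtain p where "\<And>\<gamma> x. run \<gamma> p [x] = Some (\<Phi> \<gamma> x)" unfolding computable_map_def by blast
    then have "\<Phi> = (\<lambda>\<gamma> x. the (run \<gamma> p [x]))" by (simp add: fun_eq_iff)
    then show "\<Phi> \<in> range (\<lambda>p \<gamma> x. the (run \<gamma> p [x]))" by (rule image_eqI) simp
  qed
  then show ?thesis by (rule countable_subset) simp
qed

text \<open>The oracle \<open>\<beta>\<close> is fixed before the bits are tossed, so each of the
  countably many maps yields at most one martingale, with a null set of bad sequences.\<close>

lemma AE_comp_random_unif:
  assumes "inj g"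
  shows "AE x in coin. comp_random_unif (\<lambda>i. x (g i)) \<beta>"
proof -
  have "AE x in coin. \<forall>d. martingale_name (\<Phi> \<beta>) d \<longrightarrow> limsup (\<lambda>n. ereal (d (prefix (\<lambda>i. x (g i)) n))) \<noteq> \<infinity>" for \<Phi>
  proof (cases "\<exists>d. martingale_name (\<Phi> \<beta>) d")
    case True
    then obtain d where d: "martingale_name (\<Phi> \<beta>) d" by blast
    have "d' = d" if "martingale_name (\<Phi> \<beta>) d'" for d'
      using that d real_name_unique unfolding martingale_name_def fun_eq_iff by blast
    moreover have "AE x in coin. limsup (\<lambda>n. ereal (d (prefix (\<lambda>i. x (g i)) n))) \<noteq> \<infinity>"
      using d assms by (intro AE_martingale_bounded) (auto simp: martingale_name_def)
    ultimately show ?thesis by (auto elim!: eventually_mono)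
  qed simp
  then have "AE x in coin. \<forall>\<Phi>\<in>{\<Phi>. computable_map \<Phi>}. \<forall>d. martingale_name (\<Phi> \<beta>) d \<longrightarrow>
      limsup (\<lambda>n. ereal (d (prefix (\<lambda>i. x (g i)) n))) \<noteq> \<infinity>"
    by (subst AE_ball_countable[OF countable_computable_map]) blast
  then show ?thesis by eventually_elim (auto simp: comp_random_unif_def)
qed

section \<open>Schnorr tests and forced bits\<close>

text \<open>A finite approximation to \<open>U k\<close>. The bound on \<open>L\<close> admits only
  strings of length at most \<open>s\<close>, so the first \<open>s\<close> bits decide
  membership.\<close>

definition stage :: "(nat \<Rightarrow> nat) \<Rightarrow> nat \<Rightarrow> nat \<Rightarrow> (nat \<Rightarrow> bool) set" where
  "stage u k s = {x. \<exists>i<s. \<exists>L<Suc s. Suc (str_code (prefix x L)) = u (prod_encode (k, i))}"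

lemma stage_mono: "s \<le> t \<Longrightarrow> stage u k s \<subseteq> stage u k t"
  unfolding stage_def by (intro Collect_mono) (meson Suc_le_mono less_le_trans)

lemma Union_stage:
  "(\<Union>s. stage u k s) = \<Union> {cylinder \<sigma> |\<sigma>. \<exists>i. u (prod_encode (k, i)) = Suc (str_code \<sigma>)}"
proof (rule set_eqI, rule iffI)
  fix x assume "x \<in> (\<Union>s. stage u k s)"
  then obtain i L where "u (prod_encode (k, i)) = Suc (str_code (prefix x L))"
    by (auto simp: stage_def eq_commute)
  then show "x \<in> \<Union> {cylinder \<sigma> |\<sigma>. \<exists>i. u (prod_encode (k, i)) = Suc (str_code \<sigma>)}"
    by (intro UnionI[of "cylinder (prefix x L)"] CollectI exI[of _ "prefix x L"] conjI refl exI[of _ i])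
      (auto simp: cylinder_def)
next
  fix x assume "x \<in> \<Union> {cylinder \<sigma> |\<sigma>. \<exists>i. u (prod_encode (k, i)) = Suc (str_code \<sigma>)}"
  then obtain \<sigma> i where *: "u (prod_encode (k, i)) = Suc (str_code \<sigma>)" "prefix x (length \<sigma>) = \<sigma>"
    by (auto simp: cylinder_def)
  have "x \<in> stage u k (max (Suc i) (length \<sigma>))"
    unfolding stage_def mem_Collect_eq
    by (intro exI[of _ i] exI[of _ "length \<sigma>"] conjI) (use * in auto)
  then show "x \<in> (\<Union>s. stage u k s)" by blast
qed

lemma str_code_inject: "str_code \<sigma> = str_code \<tau> \<Longrightarrow> \<sigma> = \<tau>"
  by (rule nth_equalityI) (simp_all add: length_eq_Least nth_eq_odd)

text \<open>In binary, truncation keeps the low \<open>L\<close> bits and puts the leading 1 on top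
  of them.\<close>

lemma str_code_take:
  "L \<le> length \<sigma> \<Longrightarrow> Suc (str_code (take L \<sigma>)) = Suc (str_code \<sigma>) mod 2 ^ L + 2 ^ L"
proof (induction \<sigma> arbitrary: L)
  case (Cons b \<sigma>)
  show ?case
  proof (cases L)
    case (Suc K)
    have eq: "Suc (str_code (b # \<tau>)) = 2 * Suc (str_code \<tau>) + of_bool b" for \<tau> by simp
    have "(2 * Suc (str_code \<sigma>) + of_bool b) mod 2 ^ L = 2 * (Suc (str_code \<sigma>) mod 2 ^ K) + of_bool b"
      unfolding Suc power_Suc mod_mult2_eq by simp
    then show ?thesis using Cons by (simp add: Suc eq del: str_code.simps(2))
  qed simp
qed simp

lemma str_code_image:
  "(\<lambda>\<sigma>. Suc (str_code \<sigma>)) ` {\<sigma>. length \<sigma> = s} = {2 ^ s..<2 ^ Suc s}"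
proof (rule card_subset_eq)
  show "(\<lambda>\<sigma>. Suc (str_code \<sigma>)) ` {\<sigma>. length \<sigma> = s} \<subseteq> {2 ^ s..<2 ^ Suc s}"
    using str_code_bounds by (auto simp del: power_Suc)
  have "inj_on (\<lambda>\<sigma>. Suc (str_code \<sigma>)) {\<sigma>. length \<sigma> = s}"
    by (rule inj_onI) (simp add: str_code_inject)
  then show "card ((\<lambda>\<sigma>. Suc (str_code \<sigma>)) ` {\<sigma>. length \<sigma> = s}) = card {2 ^ s..<2 ^ Suc s :: nat}"
    by (simp add: card_image card_strings)
qed simp

text \<open>Strings of length \<open>s\<close> appear as the numbers
  \<open>z = Suc (str_code \<sigma>)\<close>, and the expression with \<open>mod\<close> is the
  corresponding number for the prefix of length \<open>L\<close>. Being arithmetical, the count is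
  computable whenever \<open>u\<close> is.\<close>

definition stage_count :: "(nat \<Rightarrow> nat) \<Rightarrow> nat \<Rightarrow> nat \<Rightarrow> nat" where
  "stage_count u k s = card {z. z < 2 ^ Suc s \<and>
     2 ^ s \<le> z \<and> (\<exists>i<s. \<exists>L<Suc s. z mod 2 ^ L + 2 ^ L = u (prod_encode (k, i)))}"

lemma measure_stage: "measure coin (stage u k s) = stage_count u k s / 2 ^ s"
proof -
  let ?Q = "\<lambda>z. \<exists>i<s. \<exists>L<Suc s. z mod 2 ^ L + 2 ^ L = u (prod_encode (k, i))"
  let ?S = "{\<sigma>. length \<sigma> = s \<and> ?Q (Suc (str_code \<sigma>))}"
  have eq: "stage u k s = {x. prefix (\<lambda>i. x (id i)) s \<in> ?S}"
    unfolding stage_def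
  proof (rule Collect_cong)
    fix x
    have *: "Suc (str_code (prefix x L)) = w \<longleftrightarrow> Suc (str_code (prefix x s)) mod 2 ^ L + 2 ^ L = w"
      if "L < Suc s" for L w
      using str_code_take[of L "prefix x s"] that by (simp add: take_prefix)
    show "(\<exists>i<s. \<exists>L<Suc s. Suc (str_code (prefix x L)) = u (prod_encode (k, i)))
        \<longleftrightarrow> prefix (\<lambda>i. x (id i)) s \<in> ?S"
      by (simp add: * cong: conj_cong)
  qed
  have "measure coin (stage u k s) = card ?S / 2 ^ s"
    unfolding eq by (rule measure_coin_prefix_mem) auto
  also have "card ?S = card ((\<lambda>\<sigma>. Suc (str_code \<sigma>)) ` ?S)"
    by (rule card_image[symmetric]) (auto intro!: inj_onI str_code_inject)
  also have "(\<lambda>\<sigma>. Suc (str_code \<sigma>)) ` ?S = {z \<in> {2 ^ s..<2 ^ Suc s}. ?Q z}"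
    unfolding str_code_image[symmetric] by blast
  also have "card \<dots> = stage_count u k s"
    unfolding stage_count_def by (rule arg_cong[of _ _ card]) auto
  finally show ?thesis .
qed

lemma stage_prefix:
  assumes "prefix x n = prefix y n" "s \<le> n" "x \<in> stage u k s"
  shows "y \<in> stage u k s"
proof -
  have "prefix x L = prefix y L" if "L < Suc s" for L
    using take_prefix[of L x n] take_prefix[of L y n] assms(1,2) that by (simp add: min_absorb1)
  note eq = this
  from assms(3) obtain i L where "i < s" "L < Suc s" "Suc (str_code (prefix x L)) = u (prod_encode (k, i))"
    by (auto simp: stage_def)
  then show ?thesis unfolding stage_def using eq by auto
qed

lemma stage_sets: "stage u k s \<in> sets coin"
proof -
  have "stage u k s = {x \<in> space coin. prefix (\<lambda>i. x i) s \<in> (\<lambda>x. prefix x s) ` stage u k s}"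
  proof (rule set_eqI, rule iffI)
    fix x assume "x \<in> {x \<in> space coin. prefix (\<lambda>i. x i) s \<in> (\<lambda>x. prefix x s) ` stage u k s}"
    then obtain y where "prefix y s = prefix x s" "y \<in> stage u k s" by auto
    then show "x \<in> stage u k s" using stage_prefix by blast
  qed simp
  also have "\<dots> \<in> sets coin" by (rule prefix_mem_measurable) simp
  finally show ?thesis .
qed

lemma measure_stage_tendsto: "(\<lambda>s. measure coin (stage u k s)) \<longlonglongrightarrow> measure coin (\<Union>s. stage u k s)"
  by (intro coin.finite_Lim_measure_incseq) (auto simp: stage_sets incseq_def stage_mono)

text \<open>Computability of the measures permits a search for a stage that nearly exhausts
  \<open>U (2 * k)\<close> for all \<open>k \<le> m\<close> at once. Even indices are taken because
  their measure, at most \<open>1 / 4 ^ k\<close>, leaves room for a forcing factor of order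
  \<open>2 ^ k\<close>.\<close>

lemma schnorr_test_stages:
  assumes "schnorr_test U"
  obtains u N where "computable u" "computable N" "\<And>k. U k = (\<Union>s. stage u k s)" "\<And>m. m \<le> N m"
    "\<And>k m. k \<le> m \<Longrightarrow> measure coin (U (2 * k)) - measure coin (stage u (2 * k) (N m)) \<le> 3 / 4 ^ m"
proof -
  obtain u where u: "computable u" "\<And>k. U k = (\<Union>s. stage u k s)"
    using assms unfolding schnorr_test_def effectively_open_seq_def Union_stage[symmetric] by blast
  obtain q where q: "computable q" "\<And>k. real_name (\<lambda>j. q (prod_encode (k, j))) (measure coin (U k))"
    using assms unfolding schnorr_test_def computable_real_seq_def by blast
  \<comment> \<open>Index \<open>2 * m\<close> gives precision \<open>1 / 4 ^ m\<close>. The slack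
    is two such units, one for the approximation and one for the limit, so the search succeeds;
    passing back to the true measure adds the third. The clause \<open>m \<le> s\<close> makes the
    chosen stages exhaust the test.\<close>
  define good where "good m s \<longleftrightarrow> m \<le> s \<and> (\<forall>k<Suc m. q (prod_encode (2 * k, 2 * m)) * 2 ^ s
      \<le> stage_count u (2 * k) s * 2 ^ (2 * m) + 2 * 2 ^ s)" for m s :: nat
  have approx: "\<bar>measure coin (U k) - q (prod_encode (k, 2 * m)) / 4 ^ m\<bar> \<le> 1 / 4 ^ m" for k m
  proof -
    have "(2::real) ^ (2 * m) = 4 ^ m" by (simp add: power_mult)
    then show ?thesis using q(2)[of k] unfolding real_name_def by metis
  qed
  have good_iff: "good m s \<longleftrightarrow> m \<le> s \<and> (\<forall>k<Suc m. q (prod_encode (2 * k, 2 * m)) / 4 ^ m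
      \<le> measure coin (stage u (2 * k) s) + 2 / 4 ^ m)" for m s
  proof -
    have "a * 2 ^ s \<le> c * 2 ^ (2 * m) + 2 * 2 ^ s \<longleftrightarrow> real a / 4 ^ m \<le> c / 2 ^ s + 2 / 4 ^ m" for a c :: nat
    proof -
      have "a * 2 ^ s \<le> c * 2 ^ (2 * m) + 2 * 2 ^ s \<longleftrightarrow> real (a * 2 ^ s) \<le> real (c * 2 ^ (2 * m) + 2 * 2 ^ s)"
        by (simp only: of_nat_le_iff)
      also have "\<dots> \<longleftrightarrow> real a * 2 ^ s \<le> real c * 4 ^ m + 2 * 2 ^ s"
        by (simp add: power_mult)
      also have "\<dots> \<longleftrightarrow> real a / 4 ^ m \<le> c / 2 ^ s + 2 / 4 ^ m"
        by (simp add: field_simps)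
      finally show ?thesis .
    qed
    then show ?thesis by (simp only: good_def measure_stage)
  qed
  have good_ex: "\<exists>s. good m s" for m
  proof -
    have "eventually (\<lambda>s. q (prod_encode (2 * k, 2 * m)) / 4 ^ m \<le> measure coin (stage u (2 * k) s) + 2 / 4 ^ m) sequentially" for k
    proof -
      have "measure coin (U (2 * k)) - 1 / 4 ^ m < measure coin (\<Union>s. stage u (2 * k) s)"
        unfolding u(2) by simp
      from order_tendstoD(1)[OF measure_stage_tendsto this]
      show ?thesis
        by eventually_elim (use approx[of "2 * k" m] in \<open>auto simp: abs_le_iff algebra_simps\<close>)
    qed
    then have "eventually (\<lambda>s. \<forall>k\<in>{..<Suc m}. q (prod_encode (2 * k, 2 * m)) / 4 ^ m
        \<le> measure coin (stage u (2 * k) s) + 2 / 4 ^ m) sequentially"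
      by (intro eventually_ball_finite) auto
    with eventually_ge_at_top[of m] have "eventually (good m) sequentially"
      by eventually_elim (simp add: good_iff)
    then show ?thesis by (auto simp: eventually_sequentially)
  qed
  define N where "N m = (LEAST s. good m s)" for m
  have N_good: "good m (N m)" for m unfolding N_def using good_ex by (rule LeastI_ex)
  have "computable N" unfolding N_def
  proof (rule computable_Least)
    show "decidable (\<lambda>z. good (pfst z) (psnd z))"
      unfolding good_def stage_count_def
      by (intro computable_intros computable_mod computable_comp[OF u(1)] computable_comp[OF q(1)]) simp
  qed (rule good_ex)
  moreover have "measure coin (U (2 * k)) - measure coin (stage u (2 * k) (N m)) \<le> 3 / 4 ^ m" if "k \<le> m" for k m
  proof -
    have "q (prod_encode (2 * k, 2 * m)) / 4 ^ m \<le> measure coin (stage u (2 * k) (N m)) + 2 / 4 ^ m"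
      using N_good[of m] that unfolding good_iff by (simp add: less_Suc_eq_le)
    then show ?thesis using approx[of "2 * k" m] by (simp add: abs_le_iff)
  qed
  moreover have "m \<le> N m" for m using N_good[of m] by (simp add: good_def)
  ultimately show ?thesis using that u by blast
qed

lemma countable_schnorr_test: "countable {U. schnorr_test U}"
proof -
  have "{U. schnorr_test U} \<subseteq> (\<lambda>u k. \<Union>s. stage u k s) ` {u. computable u}"
    by (auto simp: fun_eq_iff elim!: schnorr_test_stages intro!: image_eqI)
  then show ?thesis by (rule countable_subset) (intro countable_image countable_computable)
qed

text \<open>
  If \<open>G p\<close> arises by fixing fair bits at the positions in \<open>F\<close>, then an event that depends on
  the first \<open>n\<close> bits becomes at most \<open>2 ^ card (F \<inter> {..<n})\<close> times more probable.
\<close>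

locale forced_bits = prob_space M for M :: "'p measure" +
  fixes G :: "'p \<Rightarrow> nat \<Rightarrow> bool" and F :: "nat set"
  assumes G_measurable: "\<And>c. (\<lambda>p. G p c) \<in> measurable M (count_space UNIV)"
    and forced_le: "\<And>n \<sigma>. measure M {p \<in> space M. \<forall>i<n. G p i = \<sigma> ! i} \<le> 2 ^ card ({..<n} \<inter> F) / 2 ^ n"
    and sparse: "\<And>N. computable N \<Longrightarrow> \<exists>C. \<forall>m. card ({..<N m} \<inter> F) \<le> C + m"
begin

text \<open>Such a \<open>V\<close> is a disjoint union of cylinders, to each of which
  \<open>forced_le\<close> applies.\<close>

lemma prob_finitary_le:
  assumes V: "\<And>x y. prefix x n = prefix y n \<Longrightarrow> x \<in> V \<Longrightarrow> y \<in> V"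
  shows "{p \<in> space M. G p \<in> V} \<in> events"
    and "prob {p \<in> space M. G p \<in> V} \<le> 2 ^ card ({..<n} \<inter> F) * measure coin V"
proof -
  let ?S = "(\<lambda>x. prefix x n) ` V"
  have V_iff: "x \<in> V \<longleftrightarrow> prefix x n \<in> ?S" for x
  proof
    assume "prefix x n \<in> ?S"
    then obtain y where "y \<in> V" "prefix y n = prefix x n" by auto
    then show "x \<in> V" using V by blast
  qed simp
  have eq: "{p \<in> space M. G p \<in> V} = {p \<in> space M. prefix (G p) n \<in> ?S}"
    unfolding V_iff[of "G _"] ..
  show "{p \<in> space M. G p \<in> V} \<in> events"
    unfolding eq by (rule prefix_mem_measurable) (rule G_measurable)
  have "prob {p \<in> space M. G p \<in> V} = (\<Sum>\<sigma>\<in>?S. prob {p \<in> space M. \<forall>i<n. G p i = \<sigma> ! i})"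
    unfolding eq by (rule measure_prefix_mem[OF G_measurable finite_measure_axioms]) auto
  also have "\<dots> \<le> (\<Sum>\<sigma>\<in>?S. 2 ^ card ({..<n} \<inter> F) / 2 ^ n)"
    by (intro sum_mono forced_le)
  also have "\<dots> = 2 ^ card ({..<n} \<inter> F) * (card ?S / 2 ^ n)" by simp
  also have "card ?S / 2 ^ n = measure coin V"
  proof -
    have eqV: "{x. prefix (\<lambda>i. x (id i)) n \<in> ?S} = V"
      by (intro set_eqI) (unfold mem_Collect_eq id_apply, rule V_iff[symmetric])
    have "card ?S / 2 ^ n = measure coin {x. prefix (\<lambda>i. x (id i)) n \<in> ?S}"
      by (rule measure_coin_prefix_mem[symmetric]) auto
    also have "\<dots> = measure coin V" by (rule arg_cong[OF eqV])
    finally show ?thesis .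
  qed
  finally show "prob {p \<in> space M. G p \<in> V} \<le> 2 ^ card ({..<n} \<inter> F) * measure coin V" .
qed

text \<open>\<open>U (2 * k)\<close> is cut into pieces decided by finitely many bits. Passing from
  level \<open>m\<close> to \<open>m + 1\<close> adds measure at most \<open>3 / 4 ^ m\<close>,
  which forcing multiplies by at most \<open>2 ^ (C + m + 1)\<close>. The products are summable, and
  their sum over \<open>m \<ge> k\<close> tends to 0 with growing \<open>k\<close>.\<close>

lemma AE_pass_test:
  assumes U: "schnorr_test U"
  shows "AE p in M. G p \<notin> (\<Inter>k. U k)"
proof -
  obtain u N where N: "computable N" "\<And>m. m \<le> N m" and u: "\<And>k. U k = (\<Union>s. stage u k s)"
    and close: "\<And>k m. k \<le> m \<Longrightarrow> measure coin (U (2 * k)) - measure coin (stage u (2 * k) (N m)) \<le> 3 / 4 ^ m"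
    using schnorr_test_stages[OF U] by metis
  obtain C where C: "\<And>m. card ({..<N m} \<inter> F) \<le> C + m" using sparse[OF N(1)] by blast
  have U_sets: "U k \<in> sets coin" for k unfolding u using stage_sets by blast
  have U_le: "measure coin (U k) \<le> 1 / 2 ^ k" for k using U by (simp add: schnorr_test_def)
  define E where "E k = {p \<in> space M. G p \<in> U (2 * k)}" for k
  define V where "V k m = stage u (2 * k) (N m)" for k m
  define D where "D k i = (case i of 0 \<Rightarrow> V k k | Suc i \<Rightarrow> V k (Suc (k + i)) - V k (k + i))" for k i
  \<comment> \<open>\<open>N\<close> need not be monotone, hence the maximum of the two
    lengths.\<close>
  have D_fin: "y \<in> D k i" if "prefix x n = prefix y n" "x \<in> D k i" "n = (case i of 0 \<Rightarrow> N k | Suc i \<Rightarrow> max (N (Suc (k + i))) (N (k + i)))" for x y k i n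
    using that stage_prefix[of x n y] stage_prefix[of y n x]
    by (auto simp: D_def V_def split: nat.splits)
  have D_sets: "{p \<in> space M. G p \<in> D k i} \<in> events" for k i
    by (rule prob_finitary_le(1)[of "case i of 0 \<Rightarrow> N k | Suc i \<Rightarrow> max (N (Suc (k + i))) (N (k + i))"])
      (rule D_fin, assumption, assumption, rule refl)
  \<comment> \<open>For \<open>i > 0\<close> the estimate is
    \<open>2 ^ (C + k + i) * 3 / 4 ^ (k + i - 1)\<close>, which equals the right-hand side; this is
    the origin of 12.\<close>
  have D_le: "prob {p \<in> space M. G p \<in> D k i} \<le> 2 ^ C * 12 / 2 ^ k * (1 / 2) ^ i" for k i
  proof (cases i)
    case 0
    have "prob {p \<in> space M. G p \<in> D k i} \<le> 2 ^ card ({..<N k} \<inter> F) * measure coin (D k i)"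
      by (rule prob_finitary_le(2)) (rule D_fin, assumption, assumption, simp add: 0)
    also have "\<dots> \<le> 2 ^ (C + k) * (1 / 2 ^ (2 * k))"
    proof (rule mult_mono)
      have "measure coin (D k i) \<le> measure coin (U (2 * k))"
        by (rule coin.finite_measure_mono) (auto simp: D_def V_def 0 u U_sets[unfolded u])
      then show "measure coin (D k i) \<le> 1 / 2 ^ (2 * k)" using U_le[of "2 * k"] by simp
    qed (use C in auto)
    also have "\<dots> = 2 ^ C * 1 / 2 ^ k" by (simp add: power_add mult_2)
    also have "\<dots> \<le> 2 ^ C * 12 / 2 ^ k * (1 / 2) ^ i" by (simp add: 0 divide_right_mono)
    finally show ?thesis .
  next
    case (Suc j)
    let ?n = "max (N (Suc (k + j))) (N (k + j))"
    have "prob {p \<in> space M. G p \<in> D k i} \<le> 2 ^ card ({..<?n} \<inter> F) * measure coin (D k i)"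
      by (rule prob_finitary_le(2)) (rule D_fin, assumption, assumption, simp add: Suc)
    also have "\<dots> \<le> 2 ^ (C + Suc (k + j)) * (3 / 4 ^ (k + j))"
    proof (rule mult_mono)
      have "card ({..<?n} \<inter> F) \<le> C + Suc (k + j)"
        using C[of "Suc (k + j)"] C[of "k + j"] by (simp add: max_def)
      then show "(2::real) ^ card ({..<?n} \<inter> F) \<le> 2 ^ (C + Suc (k + j))" by (intro power_increasing) auto
      have "measure coin (D k i) \<le> measure coin (U (2 * k) - V k (k + j))"
        by (rule coin.finite_measure_mono) (auto simp: D_def V_def Suc u stage_sets U_sets[unfolded u])
      also have "\<dots> = measure coin (U (2 * k)) - measure coin (V k (k + j))"
        by (rule coin.finite_measure_Diff) (auto simp: V_def u stage_sets U_sets[unfolded u])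
      also have "\<dots> \<le> 3 / 4 ^ (k + j)" unfolding V_def by (rule close) simp
      finally show "measure coin (D k i) \<le> 3 / 4 ^ (k + j)" .
    qed auto
    also have "\<dots> = 2 ^ C * 12 / 2 ^ k * (1 / 2) ^ i"
    proof -
      have "(4::real) ^ (k + j) = 2 ^ (k + j) * 2 ^ (k + j)" by (simp add: power_mult_distrib[symmetric])
      then show ?thesis by (simp add: Suc power_add power_one_over field_simps)
    qed
    finally show ?thesis .
  qed
  have E_sets: "E k \<in> events" for k
  proof -
    have "E k = (\<Union>s. {p \<in> space M. G p \<in> stage u (2 * k) s})" by (auto simp: E_def u)
    moreover have "{p \<in> space M. G p \<in> stage u (2 * k) s} \<in> events" for s
      by (rule prob_finitary_le(1)[of s]) (rule stage_prefix, assumption, simp, assumption)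
    ultimately show ?thesis by auto
  qed
  have E_le: "prob (E k) \<le> 2 ^ C * 24 / 2 ^ k" for k
  proof -
    have summ: "summable (\<lambda>i. 2 ^ C * 12 / 2 ^ k * (1 / 2 :: real) ^ i)"
      by (intro summable_mult summable_geometric) simp
    have "E k \<subseteq> (\<Union>i. {p \<in> space M. G p \<in> D k i})"
    proof
      fix p assume p: "p \<in> E k"
      then obtain s where s: "G p \<in> stage u (2 * k) s" by (auto simp: E_def u)
      have "G p \<in> V k (k + s)"
        using stage_mono[of s "N (k + s)"] N(2)[of "k + s"] s by (auto simp: V_def)
      then have ex: "\<exists>j. G p \<in> V k (k + j)" by blast
      \<comment> \<open>The first level containing the point identifies its piece.\<close>
      define j where "j = (LEAST j. G p \<in> V k (k + j))"
      have j: "G p \<in> V k (k + j)" unfolding j_def using ex by (rule LeastI_ex)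
      have "G p \<in> D k j"
      proof (cases j)
        case (Suc i)
        then have "G p \<notin> V k (k + i)" using not_less_Least[of i "\<lambda>j. G p \<in> V k (k + j)"] by (simp add: j_def)
        then show ?thesis using j by (simp add: D_def Suc)
      qed (use j in \<open>simp add: D_def\<close>)
      then show "p \<in> (\<Union>i. {p \<in> space M. G p \<in> D k i})" using p by (auto simp: E_def)
    qed
    then have "prob (E k) \<le> prob (\<Union>i. {p \<in> space M. G p \<in> D k i})"
      by (rule finite_measure_mono) (use D_sets in auto)
    also have "prob (\<Union>i. {p \<in> space M. G p \<in> D k i}) \<le> (\<Sum>i. prob {p \<in> space M. G p \<in> D k i})"
      by (rule finite_measure_subadditive_countably)
        (use D_sets D_le in \<open>auto intro!: summable_comparison_test'[OF summ]\<close>)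
    also have "\<dots> \<le> (\<Sum>i. 2 ^ C * 12 / 2 ^ k * (1 / 2 :: real) ^ i)"
      by (rule suminf_le[OF D_le _ summ]) (use D_le in \<open>auto intro!: summable_comparison_test'[OF summ]\<close>)
    also have "\<dots> = 2 ^ C * 24 / 2 ^ k"
      by (subst suminf_mult) (simp_all add: suminf_geometric summable_geometric)
    finally show ?thesis .
  qed
  have "prob (\<Inter>k. E k) \<le> 2 ^ C * 24 / 2 ^ k" for k
    using finite_measure_mono[of "\<Inter>k. E k" "E k"] E_sets[of k] E_le[of k] by force
  moreover have "(\<lambda>k. 2 ^ C * 24 / 2 ^ k :: real) \<longlonglongrightarrow> 0" by real_asymp
  ultimately have "prob (\<Inter>k. E k) \<le> 0" by (intro LIMSEQ_le_const) auto
  then have "prob (\<Inter>k. E k) = 0" by (rule antisym[OF _ measure_nonneg])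
  then have "(\<Inter>k. E k) \<in> null_sets M"
    using E_sets
    by (auto simp: null_sets_def emeasure_eq_measure intro: sets.countable_INT)
  then show ?thesis by (rule AE_I') (auto simp: E_def)
qed

lemma AE_schnorr_random: "AE p in M. schnorr_random (G p)"
proof -
  have "AE p in M. \<forall>U\<in>{U. schnorr_test U}. G p \<notin> (\<Inter>k. U k)"
    by (subst AE_ball_countable[OF countable_schnorr_test]) (use AE_pass_test in blast)
  then show ?thesis by eventually_elim (auto simp: schnorr_random_def)
qed

end

section \<open>Forcing zeros and choosing the array\<close>

definition merge_bits :: "(nat \<Rightarrow> bool) \<Rightarrow> nat set \<Rightarrow> (nat \<Rightarrow> bool) \<times> (nat \<Rightarrow> bool) \<Rightarrow> nat \<Rightarrow> bool" where
  "merge_bits A F p c = (if A c then c \<notin> F \<and> fst p c else snd p c)"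

text \<open>Every position outside \<open>F\<close> shows a fair coin of its own, so a pattern on
  the first \<open>n\<close> positions prescribes at least
  \<open>n - card ({..<n} \<inter> F)\<close> independent tosses. Separate coin sequences for
  \<open>A\<close> and its complement allow one to be fixed before the other.\<close>

lemma forced_bits_merge:
  assumes sparse: "\<And>N. computable N \<Longrightarrow> \<exists>C. \<forall>m. card ({..<N m} \<inter> F) \<le> C + m"
  shows "forced_bits (coin \<Otimes>\<^sub>M coin) (merge_bits A F) F"
proof -
  interpret P: pair_prob_space coin coin ..
  have meas [measurable]: "(\<lambda>p. merge_bits A F p c) \<in> measurable (coin \<Otimes>\<^sub>M coin) (count_space UNIV)" for c
    unfolding merge_bits_def
    by (cases "A c"; cases "c \<in> F") (simp_all add: measurable_compose[OF measurable_fst] measurable_compose[OF measurable_snd])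
  have sets_fixed: "{x. \<forall>j\<in>J. x j = a j} \<in> sets coin" if "finite J" for J a
  proof -
    have "{x \<in> space coin. \<forall>j\<in>J. x j = a j} \<in> sets coin" using that by measurable
    then show ?thesis by simp
  qed
  show ?thesis
  proof
    fix n and \<sigma> :: "bool list"
    let ?J = "{c. c < n \<and> A c \<and> c \<notin> F}" and ?K = "{c. c < n \<and> \<not> A c}"
    let ?X = "{x. \<forall>j\<in>?J. x j = \<sigma> ! j}" and ?Y = "{x. \<forall>j\<in>?K. x j = \<sigma> ! j}"
    \<comment> \<open>Dropping the constraints at the forced positions in \<open>A\<close> leaves a
      rectangle.\<close>
    have "P.prob {p \<in> space (coin \<Otimes>\<^sub>M coin). \<forall>i<n. merge_bits A F p i = \<sigma> ! i} \<le> P.prob (?X \<times> ?Y)"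
    proof (rule P.finite_measure_mono)
      show "{p \<in> space (coin \<Otimes>\<^sub>M coin). \<forall>i<n. merge_bits A F p i = \<sigma> ! i} \<subseteq> ?X \<times> ?Y"
        by (auto simp: merge_bits_def split: if_splits)
      show "?X \<times> ?Y \<in> sets (coin \<Otimes>\<^sub>M coin)" by (intro pair_measureI sets_fixed) auto
    qed
    also have "P.prob (?X \<times> ?Y) = measure coin ?X * measure coin ?Y"
      unfolding measure_def enn2real_mult[symmetric]
      by (subst coin.emeasure_pair_measure_Times[OF sets_fixed sets_fixed]) simp_all
    also have "\<dots> = 1 / 2 ^ (card ?J + card ?K)"
      by (subst (1 2) measure_coin_fixed) (simp_all add: power_add)
    also have "\<dots> \<le> 2 ^ card ({..<n} \<inter> F) / 2 ^ n"
    proof -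
      have "{..<n} \<subseteq> ({..<n} \<inter> F) \<union> (?J \<union> ?K)" by auto
      then have "card {..<n} \<le> card (({..<n} \<inter> F) \<union> (?J \<union> ?K))" by (rule card_mono[rotated]) auto
      also have "\<dots> \<le> card ({..<n} \<inter> F) + (card ?J + card ?K)"
        by (intro order_trans[OF card_Un_le] add_left_mono card_Un_le)
      finally have "(2::real) ^ n \<le> 2 ^ card ({..<n} \<inter> F) * 2 ^ (card ?J + card ?K)"
        unfolding power_add[symmetric] by (intro power_increasing) auto
      then show ?thesis by (simp add: field_simps)
    qed
    finally show "P.prob {p \<in> space (coin \<Otimes>\<^sub>M coin). \<forall>i<n. merge_bits A F p i = \<sigma> ! i} \<le> 2 ^ card ({..<n} \<inter> F) / 2 ^ n" .
  qed (rule meas, rule sparse)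
qed

theorem theorem5p20:
  fixes f :: "nat \<Rightarrow> nat"
  assumes "computable f"
    and "infinite (A_set f)"
  shows "\<exists>\<omega> :: nat \<Rightarrow> nat \<Rightarrow> bool.
           schnorr_random (join \<omega>) \<and> doob_random f \<omega> \<and> \<not> ecu_random \<omega>"
proof -
  define A where "A c \<longleftrightarrow> psnd c < f (pfst c)" for c
  have A_codes: "prod_encode ` A_set f = {c. A c}" and B_codes: "prod_encode ` B_set f = {c. \<not> A c}"
    by (auto simp: A_set_def B_set_def A_def not_less image_iff) (metis prod_encode_pfst_psnd)+
  have A_dec: "decidable A" unfolding A_def
    by (intro computable_intros computable_comp[OF assms(1)])
  have A_inf: "infinite {c. A c}"
    unfolding A_codes[symmetric] using assms(2) finite_imageD inj_prod_encode by blast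
  have rows: "finite {c. A c \<and> pfst c < n}" for n
  proof (rule finite_subset)
    show "{c. A c \<and> pfst c < n} \<subseteq> (\<Union>m<n. (\<lambda>j. prod_encode (m, j)) ` {..<f m})"
    proof
      fix c assume "c \<in> {c. A c \<and> pfst c < n}"
      then show "c \<in> (\<Union>m<n. (\<lambda>j. prod_encode (m, j)) ` {..<f m})"
        by (intro UN_I[of "pfst c"] image_eqI[of _ _ "psnd c"]) (auto simp: A_def)
    qed
  qed simp
  have B_inf: "infinite {c. \<not> A c}"
  proof -
    \<comment> \<open>Row 0 alone contributes all indices from \<open>f 0\<close> onwards.\<close>
    have "inj (\<lambda>j. prod_encode (0, f 0 + j))" by (rule injI) simp
    moreover have "range (\<lambda>j. prod_encode (0, f 0 + j)) \<subseteq> {c. \<not> A c}" by (auto simp: A_def)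
    ultimately show ?thesis by (meson infinite_iff_countable_subset)
  qed
  obtain S where S: "infinite S" "\<And>e. e \<in> S \<Longrightarrow> \<exists>t. halts_by e t"
    "\<And>h. computable h \<Longrightarrow> finite {e \<in> S. \<exists>t<h e. halts_by e t}"
    by (rule dominating_halting_times) blast
  define F where "F = (\<Union>e\<in>S. block A e)"
  interpret forced_bits "coin \<Otimes>\<^sub>M coin" "merge_bits A F" F
    by (rule forced_bits_merge) (simp only: F_def, rule card_blocks_bounded[OF S(3)])
  interpret P: pair_prob_space coin coin ..
  \<comment> \<open>By Fubini, some \<open>\<alpha>\<close> can be fixed for which almost every
    \<open>\<beta>\<close> works. It already determines the bits in \<open>A\<close>, so the oracle
    \<open>\<gamma>\<close> is fixed while \<open>\<beta>\<close> is still random.\<close>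
  have "AE \<alpha> in coin. AE \<beta> in coin. schnorr_random (merge_bits A F (\<alpha>, \<beta>))"
    by (rule P.AE_pair) (rule AE_schnorr_random)
  then obtain \<alpha> where \<alpha>: "AE \<beta> in coin. schnorr_random (merge_bits A F (\<alpha>, \<beta>))"
    using eventually_happens'[OF coin.ae_filter_bot] by blast
  define \<gamma> where "\<gamma> i \<longleftrightarrow> enumerate {c. A c} i \<notin> F \<and> \<alpha> (enumerate {c. A c} i)" for i
  have "AE \<beta> in coin. comp_random_unif (\<lambda>i. \<beta> (enumerate {c. \<not> A c} i)) \<gamma>"
    by (rule AE_comp_random_unif) (rule inj_enumerate[OF B_inf])
  with \<alpha> have "AE \<beta> in coin. schnorr_random (merge_bits A F (\<alpha>, \<beta>)) \<and>
      comp_random_unif (\<lambda>i. \<beta> (enumerate {c. \<not> A c} i)) \<gamma>" by simp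
  then obtain \<beta> where \<beta>: "schnorr_random (merge_bits A F (\<alpha>, \<beta>))"
    "comp_random_unif (\<lambda>i. \<beta> (enumerate {c. \<not> A c} i)) \<gamma>"
    using eventually_happens'[OF coin.ae_filter_bot] by blast
  define \<omega> where "\<omega> m j = merge_bits A F (\<alpha>, \<beta>) (prod_encode (m, j))" for m j
  have join: "join \<omega> = merge_bits A F (\<alpha>, \<beta>)"
    by (simp add: join_def \<omega>_def fun_eq_iff split: prod.split)
  have "bits_at \<omega> (A_set f) = \<gamma>" "bits_at \<omega> (B_set f) = (\<lambda>i. \<beta> (enumerate {c. \<not> A c} i))"
    using enumerate_in_set[OF A_inf] enumerate_in_set[OF B_inf]
    by (auto simp: bits_at_def A_codes B_codes join merge_bits_def \<gamma>_def fun_eq_iff)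
  then have "doob_random f \<omega>" using \<beta>(2) by (simp add: doob_random_def)
  moreover have "\<not> ecu_random \<omega>"
    by (rule not_ecu_randomI[OF A_dec A_inf rows S(1,2)])
      (auto simp: join merge_bits_def F_def block_def)
  ultimately show ?thesis using \<beta>(1) join by metis
qed

end
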